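(* Assume $2^{\omega_1}=\omega_2$. Then there exists a $2$-bounded coloring $c\colon[\omega_2]^2\to\omega_2$ such that for every poset $\mathbb{P}$ which is strongly proper for some stationary set $S\subseteq[H(\lambda)]^{\aleph_1}$, where $\lambda=(2^{|\mathbb{P}|})^+$, $\mathbb{P}$ does not add a $c$-rainbow subset of $\omega_2$ of size $\aleph_2$.
   Context: A coloring $c\colon[\omega_2]^2\to\omega_2$ is $2$-bounded if every fiber $c^{-1}[\{\alpha\}]$ has at most $2$ elements; a set $A$ is $c$-rainbow if $c\restriction[A]^2$ is injective. A poset $\mathbb{P}$ is strongly proper for a class of models $\mathcal{B}$ if for every $M\in\mathcal{B}$ and every $p\in M\cap\mathbb{P}$ there is $q\le p$ which is strongly $(M,\mathbb{P})$-generic, meaning: for every $q'\le q$ there is a condition $q'\restriction M\in M\cap\mathbb{P}$ such that every $t\le q'\restriction M$ with $t\in M$ is compatible with $q'$. $[H(\lambda)]^{\aleph_1}$ is the set of subsets of $H(\lambda)$ of size $\aleph_1$, with the usual notion of stationarity. *)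

theory Defs
  imports Main "HOL-Library.FuncSet" "HOL-Library.Ramsey"
begin

unbundle cardinal_syntax

section \<open>The universe of sets\<close>

text \<open>
  The theorem quantifies over all posets inside the scope of an existential quantifier, and it
  speaks about H(lambda) and about forcing over the universe. So the ambient universe of sets is a
  type satisfying the axioms of ZFC, where \<open>elts x\<close> is the collection of the elements of
  the set \<open>x\<close>. A collection of type \<^typ>\<open>'v set\<close> may be a proper class; it is a set of
  the universe iff it is in the range of \<open>elts\<close>.
  Choice is inherited from HOL: separation and replacement hold for all HOL predicates and
  functions. For the same reason every HOL bijection between two sets of the universe is itself a
  set of the universe, and the HOL cardinal comparisons agree with those of the universe.
\<close>

class zfc_universe =
  fixes elts :: "'a \<Rightarrow> 'a set"
  assumes extensionality: "elts x = elts y \<Longrightarrow> x = y"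
    and foundation: "wf {(x, y). x \<in> elts y}"
    and separation: "X \<subseteq> elts x \<Longrightarrow> X \<in> range elts"
    and pairing: "{x, y} \<in> range elts"
    and union: "(\<Union>y\<in>elts x. elts y) \<in> range elts"
    and power_set: "{y. elts y \<subseteq> elts x} \<in> range elts"
    and replacement: "F ` elts x \<in> range elts"
    and infinity: "\<exists>x. (\<exists>e\<in>elts x. elts e = {}) \<and>
                       (\<forall>y\<in>elts x. \<exists>z\<in>elts x. elts z = insert y (elts y))"

text \<open>\<open>vset X\<close> is the set with elements \<open>X\<close>; meaningful only if \<open>X\<close> is not a proper class.\<close>

definition vset :: "'v::zfc_universe set \<Rightarrow> 'v"
  where "vset X = (THE x. elts x = X)"

lemma elts_vset:
  assumes "X \<in> range elts"
  shows "elts (vset X) = X"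
proof -
  obtain x where x: "elts x = X"
    using assms by blast
  have "elts (THE x. elts x = X) = X"
    by (rule theI[of "\<lambda>x. elts x = X"], rule x) (rule extensionality, simp add: x)
  then show ?thesis
    by (simp add: vset_def)
qed

definition vpair :: "'v::zfc_universe \<Rightarrow> 'v \<Rightarrow> 'v"
  where "vpair x y = vset {vset {x}, vset {x, y}}"

definition ordinal :: "'v::zfc_universe \<Rightarrow> bool"
  where "ordinal x \<longleftrightarrow>
    (\<forall>y\<in>elts x. elts y \<subseteq> elts x) \<and> (\<forall>y\<in>elts x. \<forall>z\<in>elts y. elts z \<subseteq> elts y)"

text \<open>\<^term>\<open>natLeq\<close> is the library's cardinal aleph 0, and \<^term>\<open>cardSuc\<close> the cardinal successor.
  The von Neumann ordinals omega 1 and omega 2 are the sets of all ordinals of size at most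
  aleph 0 and at most aleph 1, respectively.\<close>

abbreviation aleph1 :: "nat set rel"
  where "aleph1 \<equiv> cardSuc natLeq"

definition omega1 :: "'v::zfc_universe"
  where "omega1 = vset {\<alpha>. ordinal \<alpha> \<and> |elts \<alpha>| \<le>o natLeq}"

definition omega2 :: "'v::zfc_universe"
  where "omega2 = vset {\<alpha>. ordinal \<alpha> \<and> |elts \<alpha>| \<le>o aleph1}"

text \<open>\<open>hereditary \<kappa>\<close> is H(kappa): all sets whose transitive closure has fewer than \<open>\<kappa>\<close> elements.\<close>

definition hereditary :: "'b rel \<Rightarrow> 'v::zfc_universe set"
  where "hereditary \<kappa> = {x. |{y. (y, x) \<in> {(u, v). u \<in> elts v}\<^sup>+}| <o \<kappa>}"


section \<open>Stationary subsets of \<open>[X]\<close> to the aleph 1\<close>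

definition aleph1_subsets :: "'a set \<Rightarrow> 'a set set"
  where "aleph1_subsets X = {M. M \<subseteq> X \<and> |M| =o aleph1}"

definition club :: "'a set \<Rightarrow> 'a set set \<Rightarrow> bool"
  where "club X C \<longleftrightarrow>
    C \<subseteq> aleph1_subsets X \<and>
    (\<forall>M\<in>aleph1_subsets X. \<exists>N\<in>C. M \<subseteq> N) \<and>
    (\<forall>D. subset.chain C D \<and> D \<noteq> {} \<and> |D| \<le>o aleph1 \<longrightarrow> \<Union>D \<in> C)"

definition stationary :: "'a set \<Rightarrow> 'a set set \<Rightarrow> bool"
  where "stationary X S \<longleftrightarrow> S \<subseteq> aleph1_subsets X \<and> (\<forall>C. club X C \<longrightarrow> S \<inter> C \<noteq> {})"


section \<open>Strongly proper posets\<close>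

text \<open>A poset has carrier \<open>elts P\<close> and order \<open>r\<close>; \<open>(q, p) \<in> r\<close> means that \<open>q \<le> p\<close>, i.e. the
  condition \<open>q\<close> is stronger. Strong properness for models \<open>M \<subseteq> H(lambda)\<close> only makes sense for
  posets in H(lambda), since otherwise \<open>M \<inter> elts P\<close> may be empty; up to isomorphism every
  infinite poset belongs to H(lambda) for lambda the successor of \<open>2\<close> to the size of the poset.\<close>

definition compatible :: "'v rel \<Rightarrow> 'v \<Rightarrow> 'v \<Rightarrow> bool"
  where "compatible r p q \<longleftrightarrow> (\<exists>s. (s, p) \<in> r \<and> (s, q) \<in> r)"

definition strongly_generic :: "'v::zfc_universe \<Rightarrow> 'v rel \<Rightarrow> 'v set \<Rightarrow> 'v \<Rightarrow> bool"
  where "strongly_generic P r M q \<longleftrightarrow>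
    (\<forall>q'. (q', q) \<in> r \<longrightarrow>
      (\<exists>u\<in>M \<inter> elts P. \<forall>t\<in>M. (t, u) \<in> r \<longrightarrow> compatible r t q'))"

definition strongly_proper :: "'v::zfc_universe \<Rightarrow> 'v rel \<Rightarrow> 'v set set \<Rightarrow> bool"
  where "strongly_proper P r \<B> \<longleftrightarrow>
    (\<forall>M\<in>\<B>. \<forall>p\<in>M \<inter> elts P. \<exists>q. (q, p) \<in> r \<and> strongly_generic P r M q)"


section \<open>Forcing\<close>

inductive name :: "'v::zfc_universe \<Rightarrow> 'v \<Rightarrow> bool" for P
  where "(\<And>z. z \<in> elts \<tau> \<Longrightarrow> \<exists>\<sigma> s. z = vpair \<sigma> s \<and> s \<in> elts P \<and> name P \<sigma>) \<Longrightarrow> name P \<tau>"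

text \<open>The canonical name of \<open>x\<close>. As a poset need not have a largest element, all conditions are
  used in place of the largest one.\<close>

function check_name :: "'v::zfc_universe \<Rightarrow> 'v \<Rightarrow> 'v"
  where "check_name P x = vset (\<Union>y\<in>elts x. vpair (check_name P y) ` elts P)"
  by auto
termination
  by (relation "inv_image {(x, y). x \<in> elts y} snd") (auto simp: foundation)

text \<open>The forcing relation for atomic formulas. The textbook recursion on names is well-founded,
  so its least solution, used here, is its only one.\<close>

inductive
  forces_mem :: "'v::zfc_universe \<Rightarrow> 'v rel \<Rightarrow> 'v \<Rightarrow> 'v \<Rightarrow> 'v \<Rightarrow> bool" and
  forces_eq :: "'v::zfc_universe \<Rightarrow> 'v rel \<Rightarrow> 'v \<Rightarrow> 'v \<Rightarrow> 'v \<Rightarrow> bool"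
  for P r
  where
    mem: "(\<And>q. (q, p) \<in> r \<Longrightarrow>
            \<exists>q' \<sigma> s. (q', q) \<in> r \<and> vpair \<sigma> s \<in> elts \<tau> \<and> (q', s) \<in> r \<and> forces_eq P r q' \<pi> \<sigma>)
          \<Longrightarrow> forces_mem P r p \<pi> \<tau>"
  | eq: "(\<And>\<sigma> s q. vpair \<sigma> s \<in> elts \<tau> \<Longrightarrow> (q, p) \<in> r \<Longrightarrow> (q, s) \<in> r \<Longrightarrow> forces_mem P r q \<sigma> \<theta>)
          \<Longrightarrow> (\<And>\<sigma> s q. vpair \<sigma> s \<in> elts \<theta> \<Longrightarrow> (q, p) \<in> r \<Longrightarrow> (q, s) \<in> r \<Longrightarrow> forces_mem P r q \<sigma> \<tau>)
          \<Longrightarrow> forces_eq P r p \<tau> \<theta>"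

text \<open>Formulas of the forcing language, with names as parameters; a quantifier binds a variable
  for names by a HOL function.\<close>

datatype 'v fm =
    FMem 'v 'v  (infix \<open>\<^bold>\<in>\<close> 50)
  | FEq 'v 'v  (infix \<open>\<^bold>=\<close> 50)
  | FNeg "'v fm"  (\<open>\<^bold>\<not> _\<close> [40] 40)
  | FAnd "'v fm" "'v fm"  (infixr \<open>\<^bold>\<and>\<close> 35)
  | FAll "'v \<Rightarrow> 'v fm"  (binder \<open>\<^bold>\<forall>\<close> 10)

abbreviation FOr :: "'v fm \<Rightarrow> 'v fm \<Rightarrow> 'v fm"  (infixr \<open>\<^bold>\<or>\<close> 30)
  where "\<phi> \<^bold>\<or> \<psi> \<equiv> \<^bold>\<not> (\<^bold>\<not> \<phi> \<^bold>\<and> \<^bold>\<not> \<psi>)"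

abbreviation FImp :: "'v fm \<Rightarrow> 'v fm \<Rightarrow> 'v fm"  (infixr \<open>\<^bold>\<longrightarrow>\<close> 25)
  where "\<phi> \<^bold>\<longrightarrow> \<psi> \<equiv> \<^bold>\<not> (\<phi> \<^bold>\<and> \<^bold>\<not> \<psi>)"

abbreviation FIff :: "'v fm \<Rightarrow> 'v fm \<Rightarrow> 'v fm"  (infixr \<open>\<^bold>\<longleftrightarrow>\<close> 25)
  where "\<phi> \<^bold>\<longleftrightarrow> \<psi> \<equiv> (\<phi> \<^bold>\<longrightarrow> \<psi>) \<^bold>\<and> (\<psi> \<^bold>\<longrightarrow> \<phi>)"

abbreviation FEx :: "('v \<Rightarrow> 'v fm) \<Rightarrow> 'v fm"  (binder \<open>\<^bold>\<exists>\<close> 10)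
  where "FEx \<phi> \<equiv> \<^bold>\<not> (\<^bold>\<forall>x. \<^bold>\<not> \<phi> x)"

primrec forces :: "'v::zfc_universe \<Rightarrow> 'v rel \<Rightarrow> 'v \<Rightarrow> 'v fm \<Rightarrow> bool"
  where
    "forces P r p (\<sigma> \<^bold>\<in> \<tau>) \<longleftrightarrow> forces_mem P r p \<sigma> \<tau>"
  | "forces P r p (\<sigma> \<^bold>= \<tau>) \<longleftrightarrow> forces_eq P r p \<sigma> \<tau>"
  | "forces P r p (\<^bold>\<not> \<phi>) \<longleftrightarrow> (\<forall>q. (q, p) \<in> r \<longrightarrow> \<not> forces P r q \<phi>)"
  | "forces P r p (\<phi> \<^bold>\<and> \<psi>) \<longleftrightarrow> forces P r p \<phi> \<and> forces P r p \<psi>"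
  | "forces P r p (FAll \<Phi>) \<longleftrightarrow> (\<forall>\<tau>. name P \<tau> \<longrightarrow> forces P r p (\<Phi> \<tau>))"


section \<open>Rainbow sets in the extension\<close>

definition fm_subset :: "'v \<Rightarrow> 'v \<Rightarrow> 'v fm"
  where "fm_subset A B = (\<^bold>\<forall>x. x \<^bold>\<in> A \<^bold>\<longrightarrow> x \<^bold>\<in> B)"

definition fm_upair :: "'v \<Rightarrow> 'v \<Rightarrow> 'v \<Rightarrow> 'v fm"  \<comment> \<open>\<open>z = {x, y}\<close>\<close>
  where "fm_upair z x y = (\<^bold>\<forall>w. w \<^bold>\<in> z \<^bold>\<longleftrightarrow> (w \<^bold>= x \<^bold>\<or> w \<^bold>= y))"

definition fm_related :: "'v \<Rightarrow> 'v \<Rightarrow> 'v \<Rightarrow> 'v fm"  \<comment> \<open>\<open>f\<close> contains the ordered pair of \<open>x\<close> and \<open>y\<close>\<close>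
  where "fm_related f x y =
    (\<^bold>\<exists>z u v. fm_upair u x x \<^bold>\<and> fm_upair v x y \<^bold>\<and> fm_upair z u v \<^bold>\<and> z \<^bold>\<in> f)"

definition fm_equinumerous :: "'v \<Rightarrow> 'v \<Rightarrow> 'v fm"
  where "fm_equinumerous A B =
    (\<^bold>\<exists>f. (\<^bold>\<forall>x. x \<^bold>\<in> A \<^bold>\<longrightarrow> (\<^bold>\<exists>y. y \<^bold>\<in> B \<^bold>\<and> fm_related f x y)) \<^bold>\<and>
         (\<^bold>\<forall>y. y \<^bold>\<in> B \<^bold>\<longrightarrow> (\<^bold>\<exists>x. x \<^bold>\<in> A \<^bold>\<and> fm_related f x y)) \<^bold>\<and>
         (\<^bold>\<forall>x y x' y'. x \<^bold>\<in> A \<^bold>\<and> y \<^bold>\<in> B \<^bold>\<and> x' \<^bold>\<in> A \<^bold>\<and> y' \<^bold>\<in> B \<^bold>\<and>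
            fm_related f x y \<^bold>\<and> fm_related f x' y' \<^bold>\<longrightarrow> (x \<^bold>= x' \<^bold>\<longleftrightarrow> y \<^bold>= y')))"

text \<open>The function \<open>c\<close>, as a set of ordered pairs, is injective on the two-element subsets of
  \<open>A\<close>.\<close>

definition fm_rainbow :: "'v \<Rightarrow> 'v \<Rightarrow> 'v fm"
  where "fm_rainbow c A =
    (\<^bold>\<forall>x y x' y' u u' z.
       x \<^bold>\<in> A \<^bold>\<and> y \<^bold>\<in> A \<^bold>\<and> \<^bold>\<not> x \<^bold>= y \<^bold>\<and> fm_upair u x y \<^bold>\<and> fm_related c u z \<^bold>\<and>
       x' \<^bold>\<in> A \<^bold>\<and> y' \<^bold>\<in> A \<^bold>\<and> \<^bold>\<not> x' \<^bold>= y' \<^bold>\<and> fm_upair u' x' y' \<^bold>\<and> fm_related c u' z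
       \<^bold>\<longrightarrow> u \<^bold>= u')"

definition two_bounded :: "('v::zfc_universe set \<Rightarrow> 'v) \<Rightarrow> bool"
  where "two_bounded c \<longleftrightarrow>
    (\<forall>\<alpha>\<in>elts omega2. finite {e \<in> [elts omega2]\<^bsup>2\<^esup>. c e = \<alpha>} \<and>
                     card {e \<in> [elts omega2]\<^bsup>2\<^esup>. c e = \<alpha>} \<le> 2)"

definition coloring_graph :: "('v::zfc_universe set \<Rightarrow> 'v) \<Rightarrow> 'v"
  where "coloring_graph c = vset ((\<lambda>e. vpair (vset e) (c e)) ` [elts omega2]\<^bsup>2\<^esup>)"

text \<open>Some condition forces that there is a c-rainbow subset of omega 2 equinumerous with omega 2.
  Here omega 2 is that of the ground model: if it is not collapsed and omega 1 is preserved, this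
  is size aleph 2 in the extension.\<close>

definition adds_rainbow :: "'v::zfc_universe \<Rightarrow> 'v rel \<Rightarrow> ('v set \<Rightarrow> 'v) \<Rightarrow> bool"
  where "adds_rainbow P r c \<longleftrightarrow>
    (\<exists>p\<in>elts P. forces P r p
      (\<^bold>\<exists>A. fm_subset A (check_name P omega2) \<^bold>\<and>
           fm_equinumerous A (check_name P omega2) \<^bold>\<and>
           fm_rainbow (check_name P (coloring_graph c)) A))"

end

theory Submission
  imports Defs "HOL-Library.Countable_Set_Type"
begin

text \<open>
  List all \<open>\<omega>\<^sub>1\<close>-sequences of pairwise disjoint edges on \<open>\<omega>\<^sub>2\<close> in order type \<open>\<omega>\<^sub>2\<close>, which is
  possible as \<open>2\<^bsup>\<omega>\<^sub>1\<^esup> = \<omega>\<^sub>2\<close>. At \<open>\<beta>\<close>, pick from every sequence listed before \<open>\<beta>\<close> with edges below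
  \<open>\<beta>\<close> one edge \<open>{a, b}\<close>, all of these disjoint, and let \<open>c{a, \<beta>} = c{b, \<beta>}\<close>.

  If \<open>p\<close> forces \<open>A\<close> to be rainbow and large, then every condition \<open>u\<close> compatible with \<open>p\<close> has an
  \<open>\<omega>\<^sub>1\<close>-sequence \<open>g\<^sub>u\<close> of disjoint edges, each forced into \<open>A\<close> by some \<open>t\<^sub>u(i) \<le> u\<close>. Take \<open>M \<in> S\<close>
  closed under all \<open>t\<^sub>u(i)\<close> and a strongly generic \<open>q \<le> p\<close>, let \<open>q' \<le> q\<close> force into \<open>A\<close> some \<open>\<beta>\<close>
  beyond the listing of the \<open>g\<^sub>u\<close> with \<open>u \<in> M\<close>, and let \<open>u\<close> be the restriction of \<open>q'\<close> to \<open>M\<close>. Then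
  \<open>\<beta>\<close> has the same color with both ends of some edge \<open>g\<^sub>u(i)\<close>, and \<open>t\<^sub>u(i) \<in> M\<close> is compatible
  with \<open>q'\<close>, a contradiction.
\<close>

section \<open>The coloring\<close>

lemma Cinfinite_aleph1: "Cinfinite aleph1"
  using Cinfinite_cardSuc natLeq_Cinfinite by blast

lemma countable_imp_ordLeq_aleph1: "countable X \<Longrightarrow> |X| \<le>o aleph1"
  by (meson cardSuc_ordLeq countable_card_le_natLeq natLeq_Card_order ordLeq_transitive)

text \<open>\<open>|T|\<close> is a well-order of least possible type, so its proper initial
  segments have size below aleph 1.\<close>

lemma countable_underS:
  assumes "|T| \<le>o aleph1" "x \<in> T"
  shows "countable (underS |T| x)"
proof -
  have "|underS |T| x| <o aleph1"
    by (rule ordLess_ordLeq_trans[OF card_of_underS assms(1)])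
      (simp_all add: Field_card_of card_of_card_order_on assms(2))
  then show ?thesis
    by (simp add: countable_card_le_natLeq cardSuc_ordLeq_ordLess natLeq_Card_order card_of_Card_order)
qed

text \<open>Edges are ordered pairs so that each has a first and a second end: the coloring will
  identify the second end with the first.\<close>

definition disjoint_pairs :: "'i set \<Rightarrow> ('i \<Rightarrow> 'a \<times> 'a) \<Rightarrow> bool"
  where "disjoint_pairs I g \<longleftrightarrow> (\<forall>i\<in>I. fst (g i) \<noteq> snd (g i) \<and>
    (\<forall>j\<in>I. i \<noteq> j \<longrightarrow> {fst (g i), snd (g i)} \<inter> {fst (g j), snd (g j)} = {}))"

text \<open>Recursion along a well-order of \<open>T\<close> of type at most \<omega>1: at each
  stage only countably many ends are used up, and \<open>G i\<close> has a pair that avoids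
  them.\<close>

lemma ex_disjoint_pairs:
  assumes T: "|T| \<le>o aleph1"
    and ex: "\<And>i X. i \<in> T \<Longrightarrow> countable X \<Longrightarrow> \<exists>(a, b)\<in>G i. a \<noteq> b \<and> a \<notin> X \<and> b \<notin> X"
  shows "\<exists>D. (\<forall>i\<in>T. D i \<in> G i) \<and> disjoint_pairs T D"
proof -
  let ?R = "|T| - Id"
  let ?P = "\<lambda>f i e. i \<in> T \<longrightarrow> e \<in> G i \<and> fst e \<noteq> snd e \<and>
    (\<forall>j. (j, i) \<in> ?R \<longrightarrow> {fst (f j), snd (f j)} \<inter> {fst e, snd e} = {})"
  have wf: "wf ?R"
    using card_of_well_order_on[of T] by (simp add: well_order_on_def)
  have "\<exists>D. \<forall>i. ?P D i (D i)"
  proof (rule dependent_wf_choice[OF wf])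
    fix i and f :: "'a \<Rightarrow> 'b \<times> 'b"
    show "\<exists>e. ?P f i e"
    proof (cases "i \<in> T")
      case True
      let ?X = "\<Union>j\<in>underS |T| i. {fst (f j), snd (f j)}"
      have "countable ?X"
        using countable_underS[OF T True] by auto
      from ex[OF True this] obtain a b where "(a, b) \<in> G i" "a \<noteq> b" "a \<notin> ?X" "b \<notin> ?X"
        by blast
      then show ?thesis
        by (intro exI[of _ "(a, b)"]) (auto simp: underS_def)
    qed auto
  qed auto
  then obtain D where D: "\<And>i. ?P D i (D i)"
    by blast
  \<comment> \<open>The recursion makes each pair disjoint from the earlier ones. Totality turns
    this into disjointness for any two indices.\<close>
  have "total_on T |T|"
    using card_of_well_order_on[of T] by (simp add: well_order_on_def linear_order_on_def)
  then have "(j, i) \<in> ?R \<or> (i, j) \<in> ?R" if "i \<in> T" "j \<in> T" "i \<noteq> j" for i j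
    using that by (auto simp: total_on_def)
  then show ?thesis
    using D by (intro exI[of _ D]) (unfold disjoint_pairs_def, blast)
qed

text \<open>By disjointness both coordinates of \<open>g\<close> are injective on \<open>I\<close>,
  so a countable \<open>X\<close> meets only countably many of the pairs.\<close>

lemma disjoint_pairs_avoid:
  assumes g: "disjoint_pairs I g" and I: "\<not> countable I" and X: "countable X"
  shows "\<exists>i\<in>I. fst (g i) \<notin> X \<and> snd (g i) \<notin> X"
proof (rule ccontr)
  assume "\<not> ?thesis"
  then have "I = {i\<in>I. fst (g i) \<in> X} \<union> {i\<in>I. snd (g i) \<in> X}"
    by blast
  moreover have "inj_on (\<lambda>i. fst (g i)) I" "inj_on (\<lambda>i. snd (g i)) I"
    using g by (auto simp: disjoint_pairs_def inj_on_def)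
  then have "countable {i\<in>I. fst (g i) \<in> X}" "countable {i\<in>I. snd (g i) \<in> X}"
    using X by (auto dest: countable_image_inj_gen)
  ultimately show False
    using I by (metis countable_Un_iff)
qed

text \<open>By \<open>seqs\<close> every family \<open>g\<close> has a code in \<open>W\<close>. The
  exceptional set \<open>X\<close> consists of the points at or below the code or an end of
  \<open>g\<close>; each of these points has at most aleph 1 predecessors.\<close>

lemma ex_two_bounded_coloring:
  fixes W :: "'a set"
  assumes W: "|W| =o cardSuc aleph1"
    and I: "|I| =o aleph1"
    and seqs: "|Func I (W \<times> W)| \<le>o |W|"
  shows "\<exists>c. c \<in> [W]\<^bsup>2\<^esup> \<rightarrow> W \<and>
    (\<forall>v\<in>W. finite {e \<in> [W]\<^bsup>2\<^esup>. c e = v} \<and> card {e \<in> [W]\<^bsup>2\<^esup>. c e = v} \<le> 2) \<and>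
    (\<forall>g\<in>Func I (W \<times> W). disjoint_pairs I g \<longrightarrow>
      (\<exists>X. |X| \<le>o aleph1 \<and> (\<forall>\<beta>\<in>W - X. \<exists>i\<in>I. fst (g i) \<noteq> \<beta> \<and> snd (g i) \<noteq> \<beta> \<and>
         c {fst (g i), \<beta>} = c {snd (g i), \<beta>})))"
proof -
  let ?below = "underS |W|"
  have below: "|?below \<beta>| \<le>o aleph1" if "\<beta> \<in> W" for \<beta>
  proof -
    have "|?below \<beta>| <o cardSuc aleph1"
      by (rule ordLess_ordIso_trans[OF card_of_underS W])
        (simp_all add: Field_card_of card_of_card_order_on that)
    then show ?thesis
      by (simp add: cardSuc_ordLeq_ordLess card_of_Card_order Cinfinite_aleph1)
  qed
  have lin: "antisym |W|" "total_on W |W|" "trans |W|"  "|W| \<subseteq> W \<times> W" "refl_on W |W|"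
    using card_of_well_order_on[of W]
    by (auto simp: well_order_on_def linear_order_on_def partial_order_on_def preorder_on_def)
  have below_total: "\<alpha> \<in> ?below \<beta> \<or> \<beta> \<in> ?below \<alpha>" if "\<alpha> \<in> W" "\<beta> \<in> W" "\<alpha> \<noteq> \<beta>" for \<alpha> \<beta>
    using lin(2) that by (auto simp: underS_def total_on_def)
  have below_asym: "\<not> (\<alpha> \<in> ?below \<beta> \<and> \<beta> \<in> ?below \<alpha>)" for \<alpha> \<beta>
    using lin(1) by (auto simp: underS_def antisym_def)
  have belowW: "\<alpha> \<in> W \<and> \<beta> \<in> W \<and> \<alpha> \<noteq> \<beta>" if "\<alpha> \<in> ?below \<beta>" for \<alpha> \<beta>
    using lin(4) that by (auto simp: underS_def)
  have uncI: "\<not> countable I"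
  proof
    assume "countable I"
    then have "|I| <o aleph1"
      by (simp add: countable_card_le_natLeq cardSuc_ordLeq_ordLess natLeq_Card_order card_of_Card_order)
    then show False
      using I not_ordLess_ordIso by blast
  qed
  obtain enc where enc: "inj_on enc (Func I (W \<times> W))" "enc ` Func I (W \<times> W) \<subseteq> W"
    using seqs by (auto simp: card_of_ordLeq[symmetric])
  have "\<not> finite W"
    using W Cinfinite_aleph1 Cinfinite_cardSuc cinfinite_mono[OF ordIso_imp_ordLeq[OF ordIso_symmetric[OF W]]]
    by (auto simp: cinfinite_def Field_card_of)
  then have "|W \<times> W| \<le>o |W|"
    using card_of_Times_same_infinite ordIso_iff_ordLeq by blast
  then obtain pc where pc: "inj_on pc (W \<times> W)" "pc ` (W \<times> W) \<subseteq> W"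
    by (auto simp: card_of_ordLeq[symmetric])
  \<comment> \<open>The families to be served at \<beta>: code and ends all precede \<beta>. As
    \<open>enc\<close> is injective, there are at most aleph 1 of them.\<close>
  define T where "T \<beta> = {g \<in> Func I (W \<times> W). disjoint_pairs I g \<and> enc g \<in> ?below \<beta> \<and>
    g ` I \<subseteq> ?below \<beta> \<times> ?below \<beta>}" for \<beta>
  have "\<exists>D. (\<forall>g\<in>T \<beta>. D g \<in> g ` I) \<and> disjoint_pairs (T \<beta>) D" if "\<beta> \<in> W" for \<beta>
  proof (rule ex_disjoint_pairs)
    have "|T \<beta>| \<le>o |?below \<beta>|"
      using enc(1) by (intro card_of_ordLeqI[of enc]) (auto simp: T_def inj_on_def)
    then show "|T \<beta>| \<le>o aleph1"
      using below[OF that] ordLeq_transitive by blast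
    fix g and X :: "'a set"
    assume g: "g \<in> T \<beta>" and X: "countable X"
    from g obtain i where "i \<in> I" "fst (g i) \<notin> X" "snd (g i) \<notin> X" "fst (g i) \<noteq> snd (g i)"
      using disjoint_pairs_avoid[OF _ uncI X, of g] by (auto simp: T_def disjoint_pairs_def)
    then show "\<exists>(a, b)\<in>g ` I. a \<noteq> b \<and> a \<notin> X \<and> b \<notin> X"
      by (intro bexI[of _ "g i"]) (auto split: prod.split)
  qed
  then obtain D where D: "\<And>\<beta> g. \<beta> \<in> W \<Longrightarrow> g \<in> T \<beta> \<Longrightarrow> D \<beta> g \<in> g ` I"
    and disj: "\<And>\<beta>. \<beta> \<in> W \<Longrightarrow> disjoint_pairs (T \<beta>) (D \<beta>)"
    by metis
  have D_below: "fst (D \<beta> g) \<in> ?below \<beta>" "snd (D \<beta> g) \<in> ?below \<beta>" if "\<beta> \<in> W" "g \<in> T \<beta>" for \<beta> g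
    using D[OF that] that by (auto simp: T_def)
  \<comment> \<open>\<open>h \<beta>\<close> moves the second end of each chosen pair to the first
    end and fixes everything else. As the chosen pairs are disjoint, the choice of \<open>g\<close>
    is unique and first ends are fixed.\<close>
  define h where "h \<beta> \<alpha> = (if \<exists>g\<in>T \<beta>. snd (D \<beta> g) = \<alpha>
    then fst (D \<beta> (SOME g. g \<in> T \<beta> \<and> snd (D \<beta> g) = \<alpha>)) else \<alpha>)" for \<beta> \<alpha>
  have h_snd: "h \<beta> (snd (D \<beta> g)) = fst (D \<beta> g)" if "\<beta> \<in> W" "g \<in> T \<beta>" for \<beta> g
  proof -
    have "g' = g" if "g' \<in> T \<beta>" "snd (D \<beta> g') = snd (D \<beta> g)" for g'
      using disj[OF \<open>\<beta> \<in> W\<close>] \<open>g \<in> T \<beta>\<close> that unfolding disjoint_pairs_def by blast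
    then have "(SOME g'. g' \<in> T \<beta> \<and> snd (D \<beta> g') = snd (D \<beta> g)) = g"
      using \<open>g \<in> T \<beta>\<close> by (intro some_equality) auto
    then show ?thesis
      using \<open>g \<in> T \<beta>\<close> by (auto simp: h_def)
  qed
  have h_fst: "h \<beta> (fst (D \<beta> g)) = fst (D \<beta> g)" if "\<beta> \<in> W" "g \<in> T \<beta>" for \<beta> g
  proof -
    have "snd (D \<beta> g') \<noteq> fst (D \<beta> g)" if "g' \<in> T \<beta>" for g'
      using disj[OF \<open>\<beta> \<in> W\<close>] \<open>g \<in> T \<beta>\<close> that unfolding disjoint_pairs_def by (metis Int_iff empty_iff insertCI)
    then show ?thesis
      by (auto simp: h_def)
  qed
  have h_cases: "h \<beta> \<alpha> = \<alpha> \<or> (\<exists>g\<in>T \<beta>. \<alpha> = snd (D \<beta> g) \<and> h \<beta> \<alpha> = fst (D \<beta> g))" if "\<beta> \<in> W" for \<beta> \<alpha>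
  proof (cases "\<exists>g\<in>T \<beta>. snd (D \<beta> g) = \<alpha>")
    case True
    then show ?thesis
      using h_snd[OF that] by metis
  next
    case False
    then show ?thesis
      by (auto simp: h_def)
  qed
  have h_in: "h \<beta> \<alpha> \<in> W" if "\<beta> \<in> W" "\<alpha> \<in> W" for \<beta> \<alpha>
    using h_cases[OF that(1), of \<alpha>] that(2) D_below[OF that(1)] belowW by metis
  \<comment> \<open>Besides \<open>v\<close> itself, only the second end of the chosen pair with
    first end \<open>v\<close> can be mapped to \<open>v\<close>.\<close>
  have fiber: "\<exists>w. \<forall>\<alpha>. h \<beta> \<alpha> = v \<longrightarrow> \<alpha> = v \<or> \<alpha> = w" if "\<beta> \<in> W" for \<beta> v
  proof (cases "\<exists>g\<in>T \<beta>. fst (D \<beta> g) = v")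
    case True
    then obtain g where g: "g \<in> T \<beta>" "fst (D \<beta> g) = v"
      by blast
    have "g' = g" if "g' \<in> T \<beta>" "fst (D \<beta> g') = v" for g'
      using disj[OF \<open>\<beta> \<in> W\<close>] that g unfolding disjoint_pairs_def by blast
    then show ?thesis
      using h_cases[OF \<open>\<beta> \<in> W\<close>] by (intro exI[of _ "snd (D \<beta> g)"]) metis
  next
    case False
    then show ?thesis
      using h_cases[OF \<open>\<beta> \<in> W\<close>] by metis
  qed
  \<comment> \<open>The color records the larger end \<beta> of the edge, so edges of equal color
    share it, and \<open>c\<close> is 2-bounded because the fibers of \<open>h \<beta>\<close> have
    at most two elements.\<close>
  define c where "c e = (SOME x. \<exists>\<alpha> \<beta>. e = {\<alpha>, \<beta>} \<and> \<alpha> \<in> ?below \<beta> \<and> x = pc (h \<beta> \<alpha>, \<beta>))" for e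
  have c: "c {\<alpha>, \<beta>} = pc (h \<beta> \<alpha>, \<beta>)" if "\<alpha> \<in> ?below \<beta>" for \<alpha> \<beta>
    unfolding c_def
  proof (rule some_equality)
    fix x assume "\<exists>\<alpha>' \<beta>'. {\<alpha>, \<beta>} = {\<alpha>', \<beta>'} \<and> \<alpha>' \<in> ?below \<beta>' \<and> x = pc (h \<beta>' \<alpha>', \<beta>')"
    then show "x = pc (h \<beta> \<alpha>, \<beta>)"
      using that below_asym by (metis doubleton_eq_iff)
  qed (use that in blast)
  have edge: "\<exists>\<alpha> \<beta>. e = {\<alpha>, \<beta>} \<and> \<alpha> \<in> ?below \<beta>" if "e \<in> [W]\<^bsup>2\<^esup>" for e
  proof -
    from that obtain \<alpha> \<beta> where "e = {\<alpha>, \<beta>}" "\<alpha> \<noteq> \<beta>" "\<alpha> \<in> W" "\<beta> \<in> W"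
      by (auto simp: nsets_def card_2_iff)
    then show ?thesis
      using below_total[of \<alpha> \<beta>] by (metis insert_commute)
  qed
  have "c \<in> [W]\<^bsup>2\<^esup> \<rightarrow> W"
  proof
    fix e assume "e \<in> [W]\<^bsup>2\<^esup>"
    then obtain \<alpha> \<beta> where "e = {\<alpha>, \<beta>}" "\<alpha> \<in> ?below \<beta>"
      using edge by blast
    then show "c e \<in> W"
      using c belowW[of \<alpha> \<beta>] h_in[of \<beta> \<alpha>] pc(2) by auto
  qed
  moreover have "finite {e \<in> [W]\<^bsup>2\<^esup>. c e = v} \<and> card {e \<in> [W]\<^bsup>2\<^esup>. c e = v} \<le> 2" for v
  proof -
    have "\<exists>e1 e2. {e \<in> [W]\<^bsup>2\<^esup>. c e = v} \<subseteq> {e1, e2}"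
    proof (cases "\<exists>u \<beta>. u \<in> W \<and> \<beta> \<in> W \<and> v = pc (u, \<beta>)")
      case True
      then obtain u \<beta> where u: "u \<in> W" "\<beta> \<in> W" "v = pc (u, \<beta>)"
        by blast
      obtain w where w: "\<And>\<alpha>. h \<beta> \<alpha> = u \<Longrightarrow> \<alpha> = u \<or> \<alpha> = w"
        using fiber[OF u(2)] by metis
      have "e = {u, \<beta>} \<or> e = {w, \<beta>}" if e_in: "e \<in> [W]\<^bsup>2\<^esup>" and e_v: "c e = v" for e
      proof -
        obtain \<alpha> \<gamma> where e: "e = {\<alpha>, \<gamma>}" "\<alpha> \<in> ?below \<gamma>"
          using edge[OF e_in] by blast
        then have "pc (h \<gamma> \<alpha>, \<gamma>) = pc (u, \<beta>)"
          using c e_v u(3) by simp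
        then have "h \<gamma> \<alpha> = u" "\<gamma> = \<beta>"
          using inj_onD[OF pc(1)] h_in belowW[OF e(2)] u by blast+
        then show ?thesis
          using w[of \<alpha>] e(1) by auto
      qed
      then show ?thesis
        by blast
    next
      case False
      have "c e \<noteq> v" if e_in: "e \<in> [W]\<^bsup>2\<^esup>" for e
      proof -
        obtain \<alpha> \<gamma> where e: "e = {\<alpha>, \<gamma>}" "\<alpha> \<in> ?below \<gamma>"
          using edge[OF e_in] by blast
        then show ?thesis
          using False c[OF e(2)] h_in[of \<gamma> \<alpha>] belowW[OF e(2)] by auto
      qed
      then show ?thesis
        by blast
    qed
    then obtain e1 e2 where sub: "{e \<in> [W]\<^bsup>2\<^esup>. c e = v} \<subseteq> {e1, e2}"
      by blast
    have "card {e1, e2} \<le> 2"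
      by (simp add: card_insert_if)
    then show ?thesis
      using sub by (meson card_mono finite.emptyI finite_insert finite_subset order_trans)
  qed
  moreover have "\<exists>X. |X| \<le>o aleph1 \<and> (\<forall>\<beta>\<in>W - X. \<exists>i\<in>I. fst (g i) \<noteq> \<beta> \<and> snd (g i) \<noteq> \<beta> \<and>
         c {fst (g i), \<beta>} = c {snd (g i), \<beta>})" if g: "g \<in> Func I (W \<times> W)" "disjoint_pairs I g" for g
  proof -
    \<comment> \<open>The points that must precede \<beta> for \<open>g\<close> to belong to
      \<open>T \<beta>\<close>. Below, \<open>X\<close> is the downward closure of
      \<open>Y\<close>.\<close>
    define Y where "Y = insert (enc g) (fst ` g ` I \<union> snd ` g ` I)"
    have YW: "Y \<subseteq> W"
      using g(1) enc(2) by (auto simp: Y_def Func_def)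
    have Ile: "|I| \<le>o aleph1"
      using I ordIso_iff_ordLeq by blast
    have "|fst ` g ` I| \<le>o aleph1" "|snd ` g ` I| \<le>o aleph1"
      by (meson Ile card_of_image ordLeq_transitive)+
    then have "|{enc g} \<union> (fst ` g ` I \<union> snd ` g ` I)| \<le>o aleph1"
      by (intro Un_Cinfinite_bound Cinfinite_aleph1) (simp_all add: countable_imp_ordLeq_aleph1)
    then have Y: "|Y| \<le>o aleph1"
      by (simp add: Y_def)
    define X where "X = (\<Union>y\<in>Y. insert y (?below y))"
    have "|insert y (?below y)| \<le>o aleph1" if "y \<in> Y" for y
    proof -
      have "|{y} \<union> ?below y| \<le>o aleph1"
        using below YW that
        by (intro Un_Cinfinite_bound Cinfinite_aleph1) (auto simp: countable_imp_ordLeq_aleph1)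
      then show ?thesis
        by simp
    qed
    then have "|X| \<le>o aleph1"
      unfolding X_def by (intro UNION_Cinfinite_bound Y Cinfinite_aleph1) blast
    moreover have "\<exists>i\<in>I. fst (g i) \<noteq> \<beta> \<and> snd (g i) \<noteq> \<beta> \<and> c {fst (g i), \<beta>} = c {snd (g i), \<beta>}"
      if \<beta>: "\<beta> \<in> W - X" for \<beta>
    proof -
      have "Y \<subseteq> ?below \<beta>"
        using \<beta> YW below_total by (auto simp: X_def)
      then have gT: "g \<in> T \<beta>"
        using g by (auto simp: T_def Y_def mem_Times_iff image_subset_iff)
      then obtain i where "i \<in> I" "D \<beta> g = g i"
        using D \<beta> by blast
      then show ?thesis
        using gT D_below[of \<beta> g] \<beta> h_fst[of \<beta> g] h_snd[of \<beta> g] c belowW by (metis DiffD1)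
    qed
    ultimately show ?thesis
      by blast
  qed
  ultimately show ?thesis
    by blast
qed

section \<open>The first two uncountable cardinals of the universe\<close>

lemma elts_vset_subset: "X \<subseteq> elts x \<Longrightarrow> elts (vset X) = X"
  by (rule elts_vset[OF separation])

lemma vset_inj: "X \<in> range elts \<Longrightarrow> Y \<in> range elts \<Longrightarrow> vset X = vset Y \<longleftrightarrow> X = Y"
  by (metis elts_vset)

lemma small_singleton: "{x} \<in> range (elts :: 'v::zfc_universe \<Rightarrow> _)"
  using pairing[of x x] by simp

lemma small_UN: "(\<Union>y\<in>elts (x :: 'v::zfc_universe). elts (F y :: 'v)) \<in> range elts"
proof -
  obtain z where z: "elts z = F ` elts x"
    using replacement[of F x] by auto
  have "(\<Union>y\<in>elts z. elts y) \<in> range elts"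
    by (rule union)
  then show ?thesis
    by (simp add: z)
qed

text \<open>A nonempty \<open>X\<close> of this size is the image of \<open>elts x\<close> under
  some function, so replacement applies.\<close>

lemma small_ordLeq:
  assumes "|X| \<le>o |elts (x :: 'v::zfc_universe)|"
  shows "X \<in> range (elts :: 'v \<Rightarrow> _)"
proof (cases "X = {}")
  case True
  then show ?thesis
    using separation[of X x] by simp
next
  case False
  then obtain F where "F ` elts x = X"
    using assms by (auto simp: card_of_ordLeq2[OF False, symmetric])
  then show ?thesis
    using replacement[of F x] by simp
qed

lemma vpair_inject [simp]:
  "vpair x y = vpair x' y' \<longleftrightarrow> x = x' \<and> y = (y' :: 'v::zfc_universe)"
  by (auto simp: vpair_def vset_inj pairing small_singleton doubleton_eq_iff)

lemma elts_vpair: "elts (vpair x y) = {vset {x}, vset {x, y}}"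
  by (simp add: vpair_def elts_vset pairing)

text \<open>Supports induction on names: the first component of a pair in \<open>z\<close> lies
  below \<open>z\<close> in the transitive closure of membership, though it need not be an element
  of \<open>z\<close>.\<close>

lemma fst_mem_trancl:
  assumes "vpair x y \<in> elts z"
  shows "(x, z) \<in> {(u, v). u \<in> elts v}\<^sup>+"
proof -
  have "(x, vset {x}) \<in> {(u, v). u \<in> elts v}\<^sup>+"
    by (rule r_into_trancl) (simp add: elts_vset small_singleton)
  moreover have "(vset {x}, vpair x y) \<in> {(u, v). u \<in> elts v}"
    by (simp add: elts_vpair)
  moreover have "(vpair x y, z) \<in> {(u, v). u \<in> elts v}"
    using assms by simp
  ultimately show ?thesis
    by (blast intro: trancl_into_trancl)
qed

section \<open>Von Neumann ordinals and how many there are of bounded size\<close>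

lemma elts_irrefl: "x \<notin> elts (x :: 'v::zfc_universe)"
  using wf_not_refl[OF foundation, of x] by auto

lemma ordinal_mem: "ordinal \<alpha> \<Longrightarrow> \<beta> \<in> elts \<alpha> \<Longrightarrow> ordinal \<beta>"
  unfolding ordinal_def by blast

lemma ordinal_subset: "ordinal \<alpha> \<Longrightarrow> \<beta> \<in> elts \<alpha> \<Longrightarrow> elts \<beta> \<subseteq> elts \<alpha>"
  by (auto simp: ordinal_def)

text \<open>Nested membership inductions: if \<alpha> and \<beta> were incomparable, the two
  induction hypotheses would put the elements of each into the other, making them equal.\<close>

lemma ordinal_linear:
  "ordinal \<alpha> \<Longrightarrow> ordinal \<beta> \<Longrightarrow> \<alpha> \<in> elts \<beta> \<or> \<alpha> = \<beta> \<or> \<beta> \<in> elts (\<alpha> :: 'v::zfc_universe)"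
proof (induction \<alpha> arbitrary: \<beta> rule: wf_induct_rule[OF foundation])
  case outer: (1 \<alpha>)
  from outer.prems(2) show ?case
  proof (induction \<beta> rule: wf_induct_rule[OF foundation])
    case inner: (1 \<beta>)
    show ?case
    proof (rule ccontr)
      assume *: "\<not> ?thesis"
      have "elts \<alpha> \<subseteq> elts \<beta>"
        using outer.IH outer.prems(1) inner.prems * ordinal_mem ordinal_subset by blast
      moreover have "elts \<beta> \<subseteq> elts \<alpha>"
        using inner outer.prems(1) * ordinal_mem ordinal_subset by blast
      ultimately have "\<alpha> = \<beta>"
        by (simp add: extensionality)
      then show False
        using * by blast
    qed
  qed
qed

text \<open>Otherwise \<open>cardSuc \<kappa>\<close> would be isomorphic to a proper initial
  segment of \<open>r\<close>, but these have size at most \<kappa>.\<close>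

lemma well_order_small_segments:
  assumes r: "well_order_on A r" and \<kappa>: "Card_order \<kappa>"
    and seg: "\<And>a. a \<in> A \<Longrightarrow> |underS r a| \<le>o \<kappa>"
  shows "|A| \<le>o cardSuc \<kappa>"
proof (rule ccontr)
  assume "\<not> ?thesis"
  then have "cardSuc \<kappa> <o |A|"
    using \<kappa> by (simp add: cardSuc_Well_order card_of_Well_order not_ordLeq_iff_ordLess)
  then have "cardSuc \<kappa> <o r"
    using card_of_least[OF r] ordLess_ordLeq_trans by blast
  moreover have wo: "Well_order r" "Field r = A"
    using r well_order_on_Well_order by auto
  ultimately obtain a where a: "a \<in> A" "cardSuc \<kappa> =o Restr r (underS r a)"
    using ordLess_iff_ordIso_Restr[of r "cardSuc \<kappa>"] cardSuc_Well_order[OF \<kappa>] by auto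
  have "Field (Restr r (underS r a)) = underS r a"
    using r wo by (intro Refl_Field_Restr2) 
      (auto simp: underS_def Field_def well_order_on_def linear_order_on_def partial_order_on_def preorder_on_def)
  moreover have "|Field (cardSuc \<kappa>)| \<le>o |Field (Restr r (underS r a))|"
    using a(2) card_of_mono2 ordIso_iff_ordLeq by blast
  ultimately have "|Field (cardSuc \<kappa>)| \<le>o \<kappa>"
    using seg[OF a(1)] ordLeq_transitive by metis
  moreover have "\<kappa> <o |Field (cardSuc \<kappa>)|"
    using card_of_Field_ordIso[OF cardSuc_Card_order[OF \<kappa>]] cardSuc_greater[OF \<kappa>]
      ordIso_symmetric ordLess_ordIso_trans by blast
  ultimately show False
    using not_ordLess_ordLeq by blast
qed

text \<open>Membership well-orders these ordinals, and the predecessors of \<alpha> are elements of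
  \<alpha>. The bound later excludes that \<omega>2 is a proper class.\<close>

lemma card_ordinals_ordLeq:
  assumes "Card_order \<kappa>"
  shows "|{\<alpha> :: 'v::zfc_universe. ordinal \<alpha> \<and> |elts \<alpha>| \<le>o \<kappa>}| \<le>o cardSuc \<kappa>"
proof -
  let ?O = "{\<alpha> :: 'v. ordinal \<alpha> \<and> |elts \<alpha>| \<le>o \<kappa>}"
  let ?r = "{(\<alpha>, \<beta>). \<alpha> \<in> ?O \<and> \<beta> \<in> ?O \<and> (\<alpha> \<in> elts \<beta> \<or> \<alpha> = \<beta>)}"
  have trans: "trans ?r"
    using ordinal_subset by (auto intro!: transI)
  have no_cycle: "\<not> (\<alpha> \<in> elts \<beta> \<and> \<beta> \<in> elts \<alpha>)" if "ordinal \<alpha>" for \<alpha> \<beta> :: 'v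
    using ordinal_subset[OF that] elts_irrefl by blast
  have "well_order_on ?O ?r"
    unfolding well_order_on_def linear_order_on_def partial_order_on_def preorder_on_def
  proof (intro conjI)
    show "refl_on ?O ?r" "?r \<subseteq> ?O \<times> ?O"
      by (auto simp: refl_on_def)
    show "antisym ?r"
      using no_cycle by (auto intro!: antisymI)
    show "total_on ?O ?r"
      using ordinal_linear by (auto simp: total_on_def)
    show "wf (?r - Id)"
      by (rule wf_subset[OF foundation]) auto
  qed (rule trans)
  then show ?thesis
  proof (rule well_order_small_segments[OF _ assms])
    fix \<alpha> assume \<alpha>: "\<alpha> \<in> ?O"
    have "|underS ?r \<alpha>| \<le>o |elts \<alpha>|"
      by (intro card_of_mono1) (auto simp: underS_def)
    then show "|underS ?r \<alpha>| \<le>o \<kappa>"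
      using \<alpha> ordLeq_transitive by blast
  qed
qed

text \<open>Were the inductive set finite, membership on it would have a maximal element
  \<open>m\<close>, contradicting that the successor of \<open>m\<close> also belongs to it.\<close>

lemma ex_infinite: "\<exists>x :: 'v::zfc_universe. infinite (elts x)"
proof -
  obtain x :: 'v where x: "(\<exists>e\<in>elts x. elts e = {}) \<and>
      (\<forall>y\<in>elts x. \<exists>z\<in>elts x. elts z = insert y (elts y))"
    using infinity by (rule exE)
  from x obtain e where e: "e \<in> elts x"
    by blast
  have "infinite (elts x)"
  proof
    assume "finite (elts x)"
    define R where "R = {(u, v). u \<in> elts v} \<inter> elts x \<times> elts x"
    have "wf R"
      by (rule wf_subset[OF foundation]) (auto simp: R_def)
    moreover have "finite R"
      using \<open>finite (elts x)\<close> by (auto simp: R_def)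
    ultimately have "wf (R\<inverse>)"
      using finite_acyclic_wf_converse wf_acyclic by blast
    then obtain m where m: "m \<in> elts x" "\<And>y. (y, m) \<in> R\<inverse> \<Longrightarrow> y \<notin> elts x"
      using e by (metis wfE_min)
    obtain z where z: "z \<in> elts x" "elts z = insert m (elts m)"
      using x \<open>m \<in> elts x\<close> by blast
    have "(z, m) \<in> R\<inverse>"
      using m(1) z by (simp add: R_def)
    then show False
      using m(2) z(1) by blast
  qed
  then show ?thesis
    by (rule exI)
qed

section \<open>\<omega>1, \<omega>2 and their cardinalities\<close>

lemma ex_Pow: "\<exists>y. |Pow (elts x)| \<le>o |elts (y :: 'v)|" for x :: "'v::zfc_universe"
proof -
  have "vset ` Pow (elts x) \<subseteq> elts (vset {y. elts y \<subseteq> elts x})"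
    by (auto simp: elts_vset power_set elts_vset_subset)
  moreover have "inj_on vset (Pow (elts x))"
    by (metis PowD elts_vset_subset inj_onI)
  ultimately show ?thesis
    by (intro exI[of _ "vset {y. elts y \<subseteq> elts x}"]) (auto intro!: card_of_ordLeqI[of vset])
qed

lemma ex_cardSuc:
  assumes "Card_order \<kappa>" "\<kappa> \<le>o |elts (x :: 'v::zfc_universe)|"
  shows "\<exists>y :: 'v. cardSuc \<kappa> \<le>o |elts y|"
proof -
  obtain y :: 'v where "|Pow (elts x)| \<le>o |elts y|"
    using ex_Pow by blast
  then have "\<kappa> <o |elts y|"
    by (rule ordLess_ordLeq_trans[OF ordLeq_ordLess_trans[OF assms(2) card_of_Pow]])
  then show ?thesis
    using cardSuc_least[OF assms(1) card_of_Card_order] by (intro exI)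
qed

text \<open>There are at most aleph 2 such ordinals, and passing twice to a power set from an
  infinite set gives a set with at least aleph 2 elements.\<close>

lemma small_omega2:
  "{\<alpha> :: 'v::zfc_universe. ordinal \<alpha> \<and> |elts \<alpha>| \<le>o aleph1} \<in> range elts"
proof -
  obtain x :: 'v where "infinite (elts x)"
    using ex_infinite by blast
  then have "natLeq \<le>o |elts x|"
    using infinite_iff_natLeq_ordLeq by metis
  then obtain y :: 'v where "aleph1 \<le>o |elts y|"
    by (rule exE[OF ex_cardSuc[OF natLeq_Card_order]])
  then obtain z :: 'v where "cardSuc aleph1 \<le>o |elts z|"
    by (rule exE[OF ex_cardSuc[OF conjunct2[OF Cinfinite_aleph1]]])
  then show ?thesis
    using Cinfinite_aleph1
    by (intro small_ordLeq[of _ z] ordLeq_transitive[OF card_ordinals_ordLeq[of aleph1]]) auto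
qed

lemma elts_omega2: "elts (omega2 :: 'v::zfc_universe) = {\<alpha>. ordinal \<alpha> \<and> |elts \<alpha>| \<le>o aleph1}"
  unfolding omega2_def by (rule elts_vset[OF small_omega2])

lemma elts_omega1: "elts (omega1 :: 'v::zfc_universe) = {\<alpha>. ordinal \<alpha> \<and> |elts \<alpha>| \<le>o natLeq}"
proof -
  have "natLeq \<le>o aleph1"
    by (rule cardSuc_ordLeq[OF natLeq_Card_order])
  then have "{\<alpha> :: 'v. ordinal \<alpha> \<and> |elts \<alpha>| \<le>o natLeq} \<subseteq> elts omega2"
    by (auto simp: elts_omega2 elim: ordLeq_transitive)
  then show ?thesis
    unfolding omega1_def by (rule elts_vset_subset)
qed

text \<open>If \<omega>1 were countable, it would be a countable ordinal and hence an element of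
  itself.\<close>

lemma aleph1_ordLeq_omega1: "aleph1 \<le>o |elts (omega1 :: 'v::zfc_universe)|"
proof (rule ccontr)
  assume "\<not> ?thesis"
  then have "|elts (omega1 :: 'v)| <o aleph1"
    by (simp add: cardSuc_Well_order card_of_Well_order natLeq_Card_order not_ordLeq_iff_ordLess)
  then have "|elts (omega1 :: 'v)| \<le>o natLeq"
    by (simp add: cardSuc_ordLeq_ordLess natLeq_Card_order card_of_Card_order)
  moreover have "ordinal (omega1 :: 'v)"
  proof -
    have "\<beta> \<in> elts omega1" if "\<alpha> \<in> elts omega1" "\<beta> \<in> elts \<alpha>" for \<alpha> \<beta> :: 'v
      using that ordinal_mem[of \<alpha> \<beta>] ordLeq_transitive[OF card_of_mono1[OF ordinal_subset[of \<alpha> \<beta>]]]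
      by (auto simp: elts_omega1)
    then show ?thesis
      unfolding ordinal_def[of omega1] using ordinal_subset[OF ordinal_mem]
      by (metis (no_types, lifting) elts_omega1 mem_Collect_eq ordinal_subset subsetI)
  qed
  ultimately have "omega1 \<in> {\<alpha> :: 'v. ordinal \<alpha> \<and> |elts \<alpha>| \<le>o natLeq}"
    by (intro CollectI conjI)
  then have "(omega1 :: 'v) \<in> elts omega1"
    by (simp only: elts_omega1[symmetric])
  then show False
    using elts_irrefl by (rule notE[rotated])
qed

text \<open>The upper bound counts ordinals; the lower bound is Cantor's theorem, transferred to
  \<omega>2 by the assumption.\<close>

lemma card_omega2:
  assumes "|Pow (elts (omega1 :: 'v::zfc_universe))| =o |elts (omega2 :: 'v)|"
  shows "|elts (omega2 :: 'v)| =o cardSuc aleph1"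
proof -
  have "aleph1 <o |elts (omega2 :: 'v)|"
    by (rule ordLess_ordIso_trans[OF ordLeq_ordLess_trans[OF aleph1_ordLeq_omega1 card_of_Pow] assms])
  then have "cardSuc aleph1 \<le>o |elts (omega2 :: 'v)|"
    by (rule cardSuc_least[OF conjunct2[OF Cinfinite_aleph1] card_of_Card_order])
  moreover have "|elts (omega2 :: 'v)| \<le>o cardSuc aleph1"
    using card_ordinals_ordLeq[of aleph1] Cinfinite_aleph1 by (simp add: elts_omega2)
  ultimately show ?thesis
    by (simp add: ordIso_iff_ordLeq)
qed

text \<open>By the assumption this is \<open>(2^omega1)^aleph1 = 2^omega1\<close>.\<close>

lemma card_omega2_sequences:
  assumes "|Pow (elts (omega1 :: 'v::zfc_universe))| =o |elts (omega2 :: 'v)|"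
  shows "|Func (Field aleph1) (elts (omega2 :: 'v) \<times> elts (omega2 :: 'v))| \<le>o |elts (omega2 :: 'v)|"
proof -
  let ?W = "elts (omega2 :: 'v)"
  let ?A = "elts (omega1 :: 'v)"
  have A: "Cinfinite |?A|"
    using cinfinite_mono[OF aleph1_ordLeq_omega1] Cinfinite_aleph1 card_of_Card_order by blast
  have W: "infinite ?W"
    using cinfinite_mono[OF ordIso_imp_ordLeq[OF ordIso_symmetric[OF card_omega2[OF assms]]]]
      Cinfinite_cardSuc[OF Cinfinite_aleph1]
    by (simp add: cinfinite_def Field_card_of)
  have pow: "|?W| =o ctwo ^c |?A|"
    unfolding ctwo_def cexp_def Field_card_of
    by (rule ordIso_transitive[OF ordIso_symmetric[OF assms] card_of_Pow_Func])
  have "|?W \<times> ?W| =o ctwo ^c |?A|"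
    by (rule ordIso_transitive[OF card_of_Times_same_infinite[OF W] pow])
  then have "|?W \<times> ?W| ^c aleph1 =o (ctwo ^c |?A| ) ^c aleph1"
    by (rule cexp_cong1[OF _ conjunct2[OF Cinfinite_aleph1]])
  also have "(ctwo ^c |?A| ) ^c aleph1 =o ctwo ^c |?A|"
    by (rule cexp_cprod_ordLeq[OF Card_order_ctwo A Cinfinite_Cnotzero[OF Cinfinite_aleph1]
          aleph1_ordLeq_omega1])
  also have "ctwo ^c |?A| =o |?W|"
    by (rule ordIso_symmetric[OF pow])
  finally show ?thesis
    by (simp add: cexp_def Field_card_of ordIso_iff_ordLeq)
qed

section \<open>The forcing relation\<close>

declare check_name.simps [simp del]

lemma elts_check_name:
  "elts (check_name P x) = (\<Union>y\<in>elts x. vpair (check_name P y) ` elts (P :: 'v::zfc_universe))"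
proof -
  have "(\<Union>y\<in>elts x. vpair (check_name P y) ` elts P) \<in> range elts"
    using small_UN[of "\<lambda>y. vset (vpair (check_name P y) ` elts P)" x]
    by (simp add: elts_vset replacement)
  then show ?thesis
    by (subst check_name.simps) (rule elts_vset)
qed

lemma vpair_mem_check_name:
  "vpair \<sigma> s \<in> elts (check_name P y) \<longleftrightarrow> (\<exists>x\<in>elts y. \<sigma> = check_name P x) \<and> s \<in> elts P"
  by (auto simp: elts_check_name)

lemma name_check_name: "name P (check_name P x)"
proof (induction x rule: wf_induct_rule[OF foundation])
  case (1 x)
  then show ?case
    by (intro name.intros) (auto simp: elts_check_name)
qed

locale forcing_poset =
  fixes P :: "'v::zfc_universe" and r :: "'v rel"
  assumes partial_order: "partial_order_on (elts P) r"
begin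

lemma le_refl: "p \<in> elts P \<Longrightarrow> (p, p) \<in> r"
  using partial_order by (auto simp: partial_order_on_def preorder_on_def refl_on_def)

lemma le_trans: "(p, q) \<in> r \<Longrightarrow> (q, s) \<in> r \<Longrightarrow> (p, s) \<in> r"
  using partial_order by (auto simp: partial_order_on_def preorder_on_def trans_def)

lemma le_in: "(p, q) \<in> r \<Longrightarrow> p \<in> elts P" "(p, q) \<in> r \<Longrightarrow> q \<in> elts P"
  using partial_order by (auto simp: partial_order_on_def preorder_on_def)

lemma le_refl_left: "(p, q) \<in> r \<Longrightarrow> (p, p) \<in> r"
  by (rule le_refl[OF le_in(1)])

section \<open>Atomic forcing: monotonicity and the laws of equality\<close>

lemma forces_mem_mono:
  assumes "forces_mem P r p \<sigma> \<tau>" "(q, p) \<in> r"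
  shows "forces_mem P r q \<sigma> \<tau>"
proof (rule forces_mem_forces_eq.mem)
  fix q' assume "(q', q) \<in> r"
  then have "(q', p) \<in> r"
    using assms(2) by (rule le_trans)
  then show "\<exists>q'' \<rho> s. (q'', q') \<in> r \<and> vpair \<rho> s \<in> elts \<tau> \<and> (q'', s) \<in> r \<and> forces_eq P r q'' \<sigma> \<rho>"
    using assms(1) by (auto simp: forces_mem.simps[of P r p])
qed

lemma forces_eq_mono:
  assumes "forces_eq P r p \<sigma> \<tau>" "(q, p) \<in> r"
  shows "forces_eq P r q \<sigma> \<tau>"
proof (rule forces_mem_forces_eq.eq)
  fix \<pi> s q' assume "vpair \<pi> s \<in> elts \<sigma>" "(q', q) \<in> r" "(q', s) \<in> r"
  then show "forces_mem P r q' \<pi> \<tau>"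
    using assms(1) le_trans[OF _ assms(2)] by (auto simp: forces_eq.simps[of P r p])
next
  fix \<pi> s q' assume "vpair \<pi> s \<in> elts \<tau>" "(q', q) \<in> r" "(q', s) \<in> r"
  then show "forces_mem P r q' \<pi> \<sigma>"
    using assms(1) le_trans[OF _ assms(2)] by (auto simp: forces_eq.simps[of P r p])
qed

lemma forces_mono: "forces P r p \<phi> \<Longrightarrow> (q, p) \<in> r \<Longrightarrow> forces P r q \<phi>"
proof (induction \<phi>)
  case (FNeg \<phi>)
  then show ?case
    using le_trans by auto
qed (auto intro: forces_mem_mono forces_eq_mono)

lemma forces_eq_sym: "forces_eq P r p \<sigma> \<tau> \<Longrightarrow> forces_eq P r p \<tau> \<sigma>"
  by (subst forces_eq.simps, subst (asm) forces_eq.simps) blast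

lemma forces_memI:
  assumes "vpair \<sigma> s \<in> elts \<tau>" "(q, s) \<in> r" "forces_eq P r q \<pi> \<sigma>"
  shows "forces_mem P r q \<pi> \<tau>"
proof (rule forces_mem_forces_eq.mem)
  fix q' assume "(q', q) \<in> r"
  then show "\<exists>q'' \<sigma> s. (q'', q') \<in> r \<and> vpair \<sigma> s \<in> elts \<tau> \<and> (q'', s) \<in> r \<and> forces_eq P r q'' \<pi> \<sigma>"
    using assms le_refl_left le_trans forces_eq_mono by blast
qed

lemma forces_memE:
  assumes "forces_mem P r p \<pi> \<tau>" "(q, p) \<in> r"
  obtains q' \<sigma> s where "(q', q) \<in> r" "vpair \<sigma> s \<in> elts \<tau>" "(q', s) \<in> r" "forces_eq P r q' \<pi> \<sigma>"
  using assms(1)[unfolded forces_mem.simps[of P r p]] assms(2) by blast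

lemma forces_eqD:
  assumes "forces_eq P r p \<tau> \<theta>" "vpair \<sigma> s \<in> elts \<tau>" "(q, p) \<in> r" "(q, s) \<in> r"
  shows "forces_mem P r q \<sigma> \<theta>"
  using assms(1)[unfolded forces_eq.simps[of P r p]] assms(2-) by blast

lemma forces_eq_refl: "p \<in> elts P \<Longrightarrow> forces_eq P r p \<tau> \<tau>"
proof (induction \<tau> arbitrary: p rule: wf_induct_rule[OF wf_trancl[OF foundation]])
  case (1 \<tau>)
  have "forces_mem P r q \<sigma> \<tau>" if "vpair \<sigma> s \<in> elts \<tau>" "(q, s) \<in> r" for \<sigma> s q
    using that 1(1)[OF fst_mem_trancl[OF that(1)] le_in(1)[OF that(2)]] by (rule forces_memI)
  then show ?case
    by (intro forces_mem_forces_eq.eq)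
qed

text \<open>Induction on the first name, for all conditions and all other names: elements of the
  outer names are matched through an element of \<tau>, strengthening the condition twice.\<close>

lemma forces_eq_trans:
  "forces_eq P r p \<sigma> \<tau> \<Longrightarrow> forces_eq P r p \<tau> \<theta> \<Longrightarrow> forces_eq P r p \<sigma> \<theta>"
proof (induction \<sigma> arbitrary: p \<tau> \<theta> rule: wf_induct_rule[OF wf_trancl[OF foundation]])
  case (1 \<sigma>)
  note IH = 1(1)[OF fst_mem_trancl] and st = 1(2) and tt = 1(3)
  show ?case
  proof (rule forces_mem_forces_eq.eq)
    fix \<pi> s q assume \<pi>: "vpair \<pi> s \<in> elts \<sigma>" and q: "(q, p) \<in> r" "(q, s) \<in> r"
    show "forces_mem P r q \<pi> \<theta>"
    proof (rule forces_mem_forces_eq.mem)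
      fix q1 assume "(q1, q) \<in> r"
      then obtain q2 \<rho> s2 where q2: "(q2, q1) \<in> r" "vpair \<rho> s2 \<in> elts \<tau>" "(q2, s2) \<in> r" "forces_eq P r q2 \<pi> \<rho>"
        using forces_memE[OF forces_eqD[OF st \<pi> q]] by blast
      have "(q2, p) \<in> r"
        using q2(1) \<open>(q1, q) \<in> r\<close> q(1) le_trans by blast
      then obtain q3 \<chi> s3 where q3: "(q3, q2) \<in> r" "vpair \<chi> s3 \<in> elts \<theta>" "(q3, s3) \<in> r" "forces_eq P r q3 \<rho> \<chi>"
        using forces_memE[OF forces_eqD[OF tt q2(2) _ q2(3)] le_refl_left] q2(1) by blast
      then show "\<exists>q' \<chi> s. (q', q1) \<in> r \<and> vpair \<chi> s \<in> elts \<theta> \<and> (q', s) \<in> r \<and> forces_eq P r q' \<pi> \<chi>"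
        using IH[OF \<pi> forces_eq_mono[OF q2(4)]] q2(1) le_trans by blast
    qed
  next
    fix \<chi> s q assume \<chi>: "vpair \<chi> s \<in> elts \<theta>" and q: "(q, p) \<in> r" "(q, s) \<in> r"
    show "forces_mem P r q \<chi> \<sigma>"
    proof (rule forces_mem_forces_eq.mem)
      fix q1 assume "(q1, q) \<in> r"
      then obtain q2 \<rho> s2 where q2: "(q2, q1) \<in> r" "vpair \<rho> s2 \<in> elts \<tau>" "(q2, s2) \<in> r" "forces_eq P r q2 \<chi> \<rho>"
        using forces_memE[OF forces_eqD[OF forces_eq_sym[OF tt] \<chi> q]] by blast
      have "(q2, p) \<in> r"
        using q2(1) \<open>(q1, q) \<in> r\<close> q(1) le_trans by blast
      then obtain q3 \<pi> s3 where q3: "(q3, q2) \<in> r" "vpair \<pi> s3 \<in> elts \<sigma>" "(q3, s3) \<in> r" "forces_eq P r q3 \<rho> \<pi>"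
        using forces_memE[OF forces_eqD[OF forces_eq_sym[OF st] q2(2) _ q2(3)] le_refl_left] q2(1) by blast
      \<comment> \<open>The induction hypothesis needs an element of \<sigma> as first name, so the
        chain is run from \<pi> to \<chi> and reversed afterwards.\<close>
      have "forces_eq P r q3 \<pi> \<chi>"
        using IH[OF q3(2) forces_eq_sym[OF q3(4)] forces_eq_sym[OF forces_eq_mono[OF q2(4) q3(1)]]] .
      then show "\<exists>q' \<pi> s. (q', q1) \<in> r \<and> vpair \<pi> s \<in> elts \<sigma> \<and> (q', s) \<in> r \<and> forces_eq P r q' \<chi> \<pi>"
        using forces_eq_sym q3 q2(1) le_trans by blast
    qed
  qed
qed

lemma forces_mem_eq:
  assumes "forces_mem P r p \<sigma> \<tau>" "forces_eq P r p \<sigma> \<sigma>'"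
  shows "forces_mem P r p \<sigma>' \<tau>"
proof (rule forces_mem_forces_eq.mem)
  fix q assume q: "(q, p) \<in> r"
  then obtain q' \<pi> s where q': "(q', q) \<in> r" "vpair \<pi> s \<in> elts \<tau>" "(q', s) \<in> r" "forces_eq P r q' \<sigma> \<pi>"
    using forces_memE[OF assms(1)] by blast
  have "forces_eq P r q' \<sigma>' \<sigma>"
    using forces_eq_sym forces_eq_mono[OF assms(2)] le_trans[OF q'(1) q] by blast
  then show "\<exists>q' \<pi> s. (q', q) \<in> r \<and> vpair \<pi> s \<in> elts \<tau> \<and> (q', s) \<in> r \<and> forces_eq P r q' \<sigma>' \<pi>"
    using q' forces_eq_trans by blast
qed

section \<open>Forcing with canonical names\<close>

lemma forces_mem_check_nameE:
  assumes "forces_mem P r p \<sigma> (check_name P y)" "p \<in> elts P"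
  obtains q x where "(q, p) \<in> r" "x \<in> elts y" "forces_eq P r q \<sigma> (check_name P x)"
  using forces_memE[OF assms(1) le_refl[OF assms(2)]] by (metis vpair_mem_check_name)

lemma forces_mem_check_nameI:
  assumes "forces_eq P r p \<sigma> (check_name P x)" "x \<in> elts y" "p \<in> elts P"
  shows "forces_mem P r p \<sigma> (check_name P y)"
proof (rule forces_memI)
  show "vpair (check_name P x) p \<in> elts (check_name P y)"
    using assms(2,3) by (auto simp: vpair_mem_check_name)
qed (rule le_refl[OF assms(3)], rule assms(1))

lemma forces_check_name_mem: "x \<in> elts y \<Longrightarrow> p \<in> elts P \<Longrightarrow> forces_mem P r p (check_name P x) (check_name P y)"
  by (rule forces_mem_check_nameI[OF forces_eq_refl])

text \<open>Induction on \<open>x\<close>: some stronger condition forces a given element of either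
  set to equal an element of the other, and the hypothesis for elements of \<open>x\<close> makes
  the two the same.\<close>

lemma check_name_eqD:
  "forces_eq P r p (check_name P x) (check_name P y) \<Longrightarrow> p \<in> elts P \<Longrightarrow> x = y"
proof (induction x arbitrary: p y rule: wf_induct_rule[OF foundation])
  case (1 x)
  note IH = 1(1) and eq = 1(2) and p = 1(3)
  have "a \<in> elts y" if "a \<in> elts x" for a
  proof -
    have "forces_mem P r p (check_name P a) (check_name P y)"
      using forces_eqD[OF eq _ le_refl[OF p] le_refl[OF p]] that p by (auto simp: vpair_mem_check_name)
    then obtain q b where "(q, p) \<in> r" "b \<in> elts y" "forces_eq P r q (check_name P a) (check_name P b)"
      using forces_mem_check_nameE p by blast
    then show ?thesis
      using IH that le_in(1) by blast
  qed
  moreover have "b \<in> elts x" if "b \<in> elts y" for b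
  proof -
    have "forces_mem P r p (check_name P b) (check_name P x)"
      using forces_eqD[OF forces_eq_sym[OF eq] _ le_refl[OF p] le_refl[OF p]] that p
      by (auto simp: vpair_mem_check_name)
    then obtain q a where "(q, p) \<in> r" "a \<in> elts x" "forces_eq P r q (check_name P b) (check_name P a)"
      using forces_mem_check_nameE p by blast
    then show ?thesis
      using IH[of a q b] forces_eq_sym le_in(1) by blast
  qed
  ultimately show ?case
    by (intro extensionality) blast
qed

section \<open>Derived connectives and the formulas for pairs\<close>

lemma forces_FExE:
  assumes "forces P r p (FEx \<Phi>)" "p \<in> elts P"
  obtains q \<tau> where "(q, p) \<in> r" "name P \<tau>" "forces P r q (\<Phi> \<tau>)"
  using assms(1) le_refl[OF assms(2)] by auto

lemma forces_FNegE:
  assumes "forces P r p (\<^bold>\<not> \<phi>)" "forces P r q \<phi>"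
  shows "(q, p) \<notin> r"
  using assms by auto

lemma forces_FExI:
  assumes "forces P r p (\<Phi> \<tau>)" "name P \<tau>"
  shows "forces P r p (FEx \<Phi>)"
  unfolding forces.simps(3)[of _ _ p]
proof (intro allI impI notI)
  fix q assume q: "(q, p) \<in> r" and "forces P r q (\<^bold>\<forall>x. \<^bold>\<not> \<Phi> x)"
  then have "forces P r q (\<^bold>\<not> \<Phi> \<tau>)"
    using assms(2) by simp
  then show False
    using forces_FNegE[OF _ forces_mono[OF assms(1) q]] le_refl_left[OF q] by simp
qed

lemma forces_FOrE:
  assumes "forces P r p (\<phi> \<^bold>\<or> \<psi>)" "p \<in> elts P"
  obtains q where "(q, p) \<in> r" "forces P r q \<phi> \<or> forces P r q \<psi>"
proof -
  have "\<not> forces P r p (\<^bold>\<not> \<phi> \<^bold>\<and> \<^bold>\<not> \<psi>)"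
    using forces_FNegE[OF assms(1)] le_refl[OF assms(2)] by blast
  then show thesis
    using that by auto
qed

lemma forces_FOrI:
  assumes "forces P r p \<phi> \<or> forces P r p \<psi>"
  shows "forces P r p (\<phi> \<^bold>\<or> \<psi>)"
  unfolding forces.simps(3)[of _ _ p]
proof (intro allI impI notI)
  fix q assume q: "(q, p) \<in> r" "forces P r q (\<^bold>\<not> \<phi> \<^bold>\<and> \<^bold>\<not> \<psi>)"
  from assms have "forces P r q \<phi> \<or> forces P r q \<psi>"
    using forces_mono[OF _ q(1)] by (elim disjE) simp_all
  then show False
    using q(2) le_refl_left[OF q(1)] by auto
qed

text \<open>An implication is a negated conjunction, so its conclusion is obtained at a stronger
  condition. The argument is always free to strengthen.\<close>

lemma forces_FImpE:
  assumes "forces P r p (\<phi> \<^bold>\<longrightarrow> \<psi>)" "forces P r p \<phi>" "p \<in> elts P"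
  obtains q where "(q, p) \<in> r" "forces P r q \<psi>"
proof -
  have "\<not> forces P r p (\<phi> \<^bold>\<and> \<^bold>\<not> \<psi>)"
    using forces_FNegE[OF assms(1)] le_refl[OF assms(3)] by blast
  then show thesis
    using that assms(2) by auto
qed

lemma forces_FImpI:
  assumes "\<And>q. (q, p) \<in> r \<Longrightarrow> forces P r q \<phi> \<Longrightarrow> \<exists>q'. (q', q) \<in> r \<and> forces P r q' \<psi>"
  shows "forces P r p (\<phi> \<^bold>\<longrightarrow> \<psi>)"
  unfolding forces.simps(3,4)
proof (intro allI impI notI)
  fix q assume q: "(q, p) \<in> r" "forces P r q \<phi> \<and> (\<forall>q'. (q', q) \<in> r \<longrightarrow> \<not> forces P r q' \<psi>)"
  then obtain q' where "(q', q) \<in> r" "forces P r q' \<psi>"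
    using assms by blast
  then show False
    using q(2) by simp
qed

lemma forces_upair:
  assumes "elts z = {x, y}" "p \<in> elts P"
  shows "forces P r p (fm_upair (check_name P z) (check_name P x) (check_name P y))"
  unfolding fm_upair_def forces.simps(5)
proof (intro allI impI)
  fix w
  let ?mem = "w \<^bold>\<in> check_name P z" and ?or = "w \<^bold>= check_name P x \<^bold>\<or> w \<^bold>= check_name P y"
  have "forces P r p (?mem \<^bold>\<longrightarrow> ?or)"
  proof (rule forces_FImpI)
    fix q assume "(q, p) \<in> r" "forces P r q ?mem"
    then obtain q' a where "(q', q) \<in> r" "a \<in> elts z" "forces_eq P r q' w (check_name P a)"
      using forces_mem_check_nameE le_in(1) by (metis forces.simps(1))
    then show "\<exists>q'. (q', q) \<in> r \<and> forces P r q' ?or"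
      using forces_FOrI assms(1) by (metis forces.simps(2) insertE singletonD)
  qed
  moreover have "forces P r p (?or \<^bold>\<longrightarrow> ?mem)"
  proof (rule forces_FImpI)
    fix q assume "(q, p) \<in> r" "forces P r q ?or"
    then obtain q' where q': "(q', q) \<in> r"
      "forces P r q' (w \<^bold>= check_name P x) \<or> forces P r q' (w \<^bold>= check_name P y)"
      using forces_FOrE le_in(1) by metis
    then have "forces P r q' ?mem"
      using forces_mem_check_nameI[of q' w _ z] le_in(1)[OF q'(1)] assms(1)
      by (metis forces.simps(1,2) insertCI)
    then show "\<exists>q'. (q', q) \<in> r \<and> forces P r q' ?mem"
      using q' by blast
  qed
  ultimately show "forces P r p ((?mem \<^bold>\<longleftrightarrow> ?or))"
    by (simp only: forces.simps(4) simp_thms)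
qed

lemma forces_related:
  assumes "vpair x y \<in> elts f" "p \<in> elts P"
  shows "forces P r p (fm_related (check_name P f) (check_name P x) (check_name P y))"
proof -
  have "forces P r p (fm_upair (check_name P (vset {x})) (check_name P x) (check_name P x) \<^bold>\<and>
      fm_upair (check_name P (vset {x, y})) (check_name P x) (check_name P y) \<^bold>\<and>
      fm_upair (check_name P (vpair x y)) (check_name P (vset {x})) (check_name P (vset {x, y})) \<^bold>\<and>
      check_name P (vpair x y) \<^bold>\<in> check_name P f)"
    unfolding forces.simps(4) using assms
    by (intro conjI forces_upair) (auto simp: elts_vset small_singleton pairing elts_vpair forces_check_name_mem)
  then show ?thesis
    unfolding fm_related_def
    by (rule forces_FExI[where \<tau> = "check_name P (vpair x y)", OF
          forces_FExI[where \<tau> = "check_name P (vset {x})", OF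
            forces_FExI[where \<tau> = "check_name P (vset {x, y})"]]]) (rule name_check_name)+
qed

text \<open>The two edges at \<beta> and their common color are given by canonical names, so some
  stronger condition would force the edges, which differ in the ground model, to be equal.\<close>

lemma fm_rainbow_contradiction:
  assumes rainbow: "forces P r p (fm_rainbow (check_name P (coloring_graph c)) A)"
    and mem: "forces_mem P r p (check_name P a) A" "forces_mem P r p (check_name P b) A"
      "forces_mem P r p (check_name P \<beta>) A"
    and in_omega2: "a \<in> elts omega2" "b \<in> elts omega2" "\<beta> \<in> elts omega2"
    and neq: "a \<noteq> b" "a \<noteq> \<beta>" "b \<noteq> \<beta>"
    and same: "c {a, \<beta>} = c {b, \<beta>}"
    and p: "p \<in> elts P"
  shows False
proof -
  \<comment> \<open>The graph must be a set for \<open>coloring_graph\<close> to have the intended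
    elements: it is covered by an image of the power set of \<omega>2.\<close>
  have small: "(\<lambda>e. vpair (vset e) (c e)) ` [elts omega2]\<^bsup>2\<^esup> \<in> range elts"
  proof -
    let ?Pow = "vset {y. elts y \<subseteq> elts (omega2 :: 'v)}"
    have "[elts omega2]\<^bsup>2\<^esup> \<subseteq> elts ` elts ?Pow"
    proof
      fix e :: "'v set" assume "e \<in> [elts omega2]\<^bsup>2\<^esup>"
      then have "e \<subseteq> elts omega2"
        by (simp add: nsets_def)
      then have "elts (vset e) = e"
        by (rule elts_vset_subset)
      then show "e \<in> elts ` elts ?Pow"
        using \<open>e \<subseteq> elts omega2\<close> by (auto simp: elts_vset power_set intro!: image_eqI[of _ _ "vset e"])
    qed
    then have "(\<lambda>e. vpair (vset e) (c e)) ` [elts omega2]\<^bsup>2\<^esup> \<subseteq>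
        (\<lambda>z. vpair (vset (elts z)) (c (elts z))) ` elts ?Pow"
      by auto
    moreover obtain w where "elts w = (\<lambda>z. vpair (vset (elts z)) (c (elts z))) ` elts ?Pow"
      using replacement by (metis rangeE)
    ultimately show ?thesis
      using separation by metis
  qed
  let ?c = "check_name P"
  have graph: "vpair (vset {x, \<beta>}) (c {x, \<beta>}) \<in> elts (coloring_graph c)"
    if "x \<in> elts omega2" "x \<noteq> \<beta>" for x
  proof -
    have "{x, \<beta>} \<in> [elts omega2]\<^bsup>2\<^esup>"
      using that in_omega2(3) by (simp add: nsets_def)
    then show ?thesis
      unfolding coloring_graph_def elts_vset[OF small] by (rule imageI)
  qed
  have diff: "forces P r p (\<^bold>\<not> ?c x \<^bold>= ?c \<beta>)" if "x \<noteq> \<beta>" for x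
    using that check_name_eqD le_in(1) by auto
  have edge: "forces P r p (fm_upair (?c (vset {x, \<beta>})) (?c x) (?c \<beta>))" for x
    using p by (intro forces_upair) (simp_all add: elts_vset pairing)
  \<comment> \<open>The premises of \<open>fm_rainbow\<close> with \<open>c {a, \<beta>}\<close> as
    the color of both edges; for the second edge this uses \<open>same\<close>.\<close>
  have "forces P r p (?c a \<^bold>\<in> A \<^bold>\<and> ?c \<beta> \<^bold>\<in> A \<^bold>\<and> \<^bold>\<not> ?c a \<^bold>= ?c \<beta> \<^bold>\<and>
      fm_upair (?c (vset {a, \<beta>})) (?c a) (?c \<beta>) \<^bold>\<and>
      fm_related (?c (coloring_graph c)) (?c (vset {a, \<beta>})) (?c (c {a, \<beta>})) \<^bold>\<and>
      ?c b \<^bold>\<in> A \<^bold>\<and> ?c \<beta> \<^bold>\<in> A \<^bold>\<and> \<^bold>\<not> ?c b \<^bold>= ?c \<beta> \<^bold>\<and>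
      fm_upair (?c (vset {b, \<beta>})) (?c b) (?c \<beta>) \<^bold>\<and>
      fm_related (?c (coloring_graph c)) (?c (vset {b, \<beta>})) (?c (c {a, \<beta>})))"
    unfolding forces.simps(1,4) using mem neq p in_omega2
    by (intro conjI diff edge forces_related graph) (auto simp: same intro!: graph)
  moreover have "forces P r p (?c a \<^bold>\<in> A \<^bold>\<and> ?c \<beta> \<^bold>\<in> A \<^bold>\<and> \<^bold>\<not> ?c a \<^bold>= ?c \<beta> \<^bold>\<and>
      fm_upair (?c (vset {a, \<beta>})) (?c a) (?c \<beta>) \<^bold>\<and>
      fm_related (?c (coloring_graph c)) (?c (vset {a, \<beta>})) (?c (c {a, \<beta>})) \<^bold>\<and>
      ?c b \<^bold>\<in> A \<^bold>\<and> ?c \<beta> \<^bold>\<in> A \<^bold>\<and> \<^bold>\<not> ?c b \<^bold>= ?c \<beta> \<^bold>\<and>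
      fm_upair (?c (vset {b, \<beta>})) (?c b) (?c \<beta>) \<^bold>\<and>
      fm_related (?c (coloring_graph c)) (?c (vset {b, \<beta>})) (?c (c {a, \<beta>}))
      \<^bold>\<longrightarrow> ?c (vset {a, \<beta>}) \<^bold>= ?c (vset {b, \<beta>}))"
    using rainbow name_check_name unfolding fm_rainbow_def forces.simps(5) by blast
  ultimately obtain q where "(q, p) \<in> r" "forces P r q (?c (vset {a, \<beta>}) \<^bold>= ?c (vset {b, \<beta>}))"
    using forces_FImpE p by metis
  then have "vset {a, \<beta>} = vset {b, \<beta>}"
    using check_name_eqD le_in(1) by auto
  then show False
    using neq by (auto simp: vset_inj pairing doubleton_eq_iff)
qed

end

section \<open>Club many models closed under given functions\<close>

lemma Un_aleph1_bound: "|A| \<le>o aleph1 \<Longrightarrow> |B| \<le>o aleph1 \<Longrightarrow> |A \<union> B| \<le>o aleph1"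
  using Un_Cinfinite_bound Cinfinite_aleph1 by blast

lemma UN_aleph1_bound:
  "|I| \<le>o aleph1 \<Longrightarrow> (\<And>i. i \<in> I \<Longrightarrow> |A i| \<le>o aleph1) \<Longrightarrow> |\<Union>i\<in>I. A i| \<le>o aleph1"
  by (intro UNION_Cinfinite_bound Cinfinite_aleph1) auto

lemma image_aleph1_bound: "|A| \<le>o aleph1 \<Longrightarrow> |f ` A| \<le>o aleph1"
  using card_of_image ordLeq_transitive by blast

lemma aleph1_subsets_superset:
  "M \<in> aleph1_subsets X \<Longrightarrow> M \<subseteq> N \<Longrightarrow> N \<subseteq> X \<Longrightarrow> |N| \<le>o aleph1 \<Longrightarrow> N \<in> aleph1_subsets X"
  using card_of_mono1[of M N] ordIso_ordLeq_trans[OF ordIso_symmetric[of "|M|" aleph1]]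
  by (auto simp: aleph1_subsets_def ordIso_iff_ordLeq)

text \<open>Closing off in \<omega> rounds gives unboundedness. Since the functions are unary, each
  value is computed inside a single member of a chain, so unions of chains remain closed.\<close>

lemma club_closed_under:
  assumes I: "|I| \<le>o aleph1" and x0: "x0 \<in> X"
    and F: "\<And>i x. i \<in> I \<Longrightarrow> x \<in> X \<Longrightarrow> F i x \<in> X"
  shows "club X {M \<in> aleph1_subsets X. x0 \<in> M \<and> (\<forall>i\<in>I. \<forall>x\<in>M. F i x \<in> M)}"
    (is "club X ?C")
  unfolding club_def
proof (intro conjI ballI allI impI)
  fix M assume M: "M \<in> aleph1_subsets X"
  define N where "N = rec_nat (insert x0 M) (\<lambda>_ K. K \<union> (\<Union>i\<in>I. F i ` K))"
  have N_0: "N 0 = insert x0 M" and N_Suc: "N (Suc n) = N n \<union> (\<Union>i\<in>I. F i ` N n)" for n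
    by (simp_all add: N_def)
  have bound: "N n \<subseteq> X \<and> |N n| \<le>o aleph1" for n
  proof (induction n)
    case 0
    have "|{x0} \<union> M| \<le>o aleph1"
      using M by (intro Un_aleph1_bound countable_imp_ordLeq_aleph1[of "{x0}"])
        (auto simp: aleph1_subsets_def ordIso_iff_ordLeq)
    then show ?case
      using M x0 by (simp add: N_0 aleph1_subsets_def)
  next
    case (Suc n)
    have "|\<Union>i\<in>I. F i ` N n| \<le>o aleph1"
      using I Suc by (intro UN_aleph1_bound image_aleph1_bound) auto
    then show ?case
      using Suc F by (auto simp: N_Suc intro: Un_aleph1_bound)
  qed
  have "|UNIV :: nat set| \<le>o aleph1"
    by (rule countable_imp_ordLeq_aleph1) simp
  then have "|\<Union>n. N n| \<le>o aleph1"
    using bound by (intro UN_aleph1_bound) auto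
  then have "(\<Union>n. N n) \<in> aleph1_subsets X"
    using bound N_0 by (intro aleph1_subsets_superset[OF M]) blast+
  moreover have "F i x \<in> (\<Union>n. N n)" if "i \<in> I" "x \<in> (\<Union>n. N n)" for i x
    using that N_Suc by blast
  ultimately show "\<exists>K\<in>?C. M \<subseteq> K"
    using N_0 by (intro bexI[of _ "\<Union>n. N n"]) blast+
next
  fix D assume "subset.chain ?C D \<and> D \<noteq> {} \<and> |D| \<le>o aleph1"
  then have D: "D \<subseteq> ?C" "D \<noteq> {}" "|D| \<le>o aleph1"
    by (auto simp: subset.chain_def)
  then obtain M where M: "M \<in> D" "M \<in> ?C"
    by blast
  have "|M| \<le>o aleph1" if "M \<in> D" for M
    using D(1) that by (auto simp: aleph1_subsets_def ordIso_iff_ordLeq)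
  then have "|\<Union>M\<in>D. M| \<le>o aleph1"
    by (intro UN_aleph1_bound D(3))
  then have "|\<Union>D| \<le>o aleph1"
    by simp
  moreover have "\<Union>D \<subseteq> X"
    using D(1) unfolding aleph1_subsets_def by blast
  moreover have "M \<in> aleph1_subsets X"
    using M(2) by simp
  ultimately have "\<Union>D \<in> aleph1_subsets X"
    by (intro aleph1_subsets_superset[OF _ Union_upper[OF M(1)]])
  moreover have "F i x \<in> \<Union>D" if i: "i \<in> I" and x: "x \<in> \<Union>D" for i x
  proof -
    obtain K where K: "x \<in> K" "K \<in> D"
      by (rule UnionE[OF x])
    then have "F i x \<in> K"
      using D(1) i by auto
    then show ?thesis
      by (rule UnionI[OF K(2)])
  qed
  moreover have "x0 \<in> \<Union>D"
    using M by auto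
  ultimately show "\<Union>D \<in> ?C"
    by (intro CollectI conjI ballI)
qed auto

section \<open>Names for large rainbow sets\<close>

context forcing_poset
begin

text \<open>The name \<open>z\<close>, instead of the canonical name of \<open>\<xi>\<close>, as an argument of \<^const>\<open>fm_related\<close>
  dispenses with a substitution lemma for formulas.\<close>

definition locates :: "'v \<Rightarrow> 'v \<Rightarrow> 'v \<Rightarrow> 'v \<Rightarrow> 'v \<Rightarrow> bool"
  where "locates f A t \<xi> \<delta> \<longleftrightarrow> (\<exists>z. name P z \<and> forces P r t (z \<^bold>= check_name P \<xi>) \<and>
    forces P r t (z \<^bold>\<in> A) \<and> forces P r t (fm_related f z (check_name P \<delta>)))"

lemma locates_mono: "locates f A t \<xi> \<delta> \<Longrightarrow> (s, t) \<in> r \<Longrightarrow> locates f A s \<xi> \<delta>"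
  unfolding locates_def by (meson forces_mono)

lemma locates_mem: "locates f A t \<xi> \<delta> \<Longrightarrow> forces_mem P r t (check_name P \<xi>) A"
  unfolding locates_def forces.simps(1,2) by (elim exE conjE) (rule forces_mem_eq)

text \<open>The last clause of \<open>fm_equinumerous\<close>; its biconditional expresses
  single-valuedness and injectivity together.\<close>

definition fm_injective :: "'v \<Rightarrow> 'v \<Rightarrow> 'v \<Rightarrow> 'v fm"
  where "fm_injective f A B = (\<^bold>\<forall>x y x' y'. x \<^bold>\<in> A \<^bold>\<and> y \<^bold>\<in> B \<^bold>\<and> x' \<^bold>\<in> A \<^bold>\<and> y' \<^bold>\<in> B \<^bold>\<and>
            fm_related f x y \<^bold>\<and> fm_related f x' y' \<^bold>\<longrightarrow> (x \<^bold>= x' \<^bold>\<longleftrightarrow> y \<^bold>= y'))"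

definition fm_onto :: "'v \<Rightarrow> 'v \<Rightarrow> 'v \<Rightarrow> 'v fm"
  where "fm_onto f A B = (\<^bold>\<forall>y. y \<^bold>\<in> B \<^bold>\<longrightarrow> (\<^bold>\<exists>x. x \<^bold>\<in> A \<^bold>\<and> fm_related f x y))"

text \<open>Both witnessing names are forced equal to the canonical name of \<xi>, hence to each
  other, so the values are forced equal; canonical names forced equal name the same set.\<close>

lemma locates_unique:
  assumes inj: "forces P r t (fm_injective f A (check_name P B))" and t: "t \<in> elts P"
    and loc: "locates f A t \<xi> \<delta>" "locates f A t \<xi> \<delta>'" and B: "\<delta> \<in> elts B" "\<delta>' \<in> elts B"
  shows "\<delta> = \<delta>'"
proof -
  let ?c = "check_name P"
  obtain z z' where z: "name P z" "forces P r t (z \<^bold>= ?c \<xi>)" "forces P r t (z \<^bold>\<in> A)"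
      "forces P r t (fm_related f z (?c \<delta>))"
    and z': "name P z'" "forces P r t (z' \<^bold>= ?c \<xi>)" "forces P r t (z' \<^bold>\<in> A)"
      "forces P r t (fm_related f z' (?c \<delta>'))"
    using loc unfolding locates_def by blast
  have "forces P r t (z \<^bold>\<in> A \<^bold>\<and> ?c \<delta> \<^bold>\<in> ?c B \<^bold>\<and> z' \<^bold>\<in> A \<^bold>\<and> ?c \<delta>' \<^bold>\<in> ?c B \<^bold>\<and>
      fm_related f z (?c \<delta>) \<^bold>\<and> fm_related f z' (?c \<delta>') \<^bold>\<longrightarrow> (z \<^bold>= z' \<^bold>\<longleftrightarrow> ?c \<delta> \<^bold>= ?c \<delta>'))"
    using inj z(1) z'(1) name_check_name unfolding fm_injective_def forces.simps(5) by blast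
  moreover have "forces P r t (z \<^bold>\<in> A \<^bold>\<and> ?c \<delta> \<^bold>\<in> ?c B \<^bold>\<and> z' \<^bold>\<in> A \<^bold>\<and> ?c \<delta>' \<^bold>\<in> ?c B \<^bold>\<and>
      fm_related f z (?c \<delta>) \<^bold>\<and> fm_related f z' (?c \<delta>'))"
    using z z' B t by (simp add: forces_check_name_mem)
  ultimately obtain q where q: "(q, t) \<in> r" "forces P r q (z \<^bold>= z' \<^bold>\<longleftrightarrow> ?c \<delta> \<^bold>= ?c \<delta>')"
    by (rule forces_FImpE[OF _ _ t])
  have "forces_eq P r t z z'"
    by (rule forces_eq_trans[OF _ forces_eq_sym]) (use z(2) z'(2) in simp_all)
  then have "forces P r t (z \<^bold>= z')"
    by simp
  then have eq: "forces P r q (z \<^bold>= z')"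
    by (rule forces_mono[OF _ q(1)])
  have "forces P r q (z \<^bold>= z' \<^bold>\<longrightarrow> ?c \<delta> \<^bold>= ?c \<delta>')"
    using q(2) by (simp only: forces.simps(4))
  then obtain q' where "(q', q) \<in> r" "forces P r q' (?c \<delta> \<^bold>= ?c \<delta>')"
    by (rule forces_FImpE[OF _ eq le_in(1)[OF q(1)]])
  then show ?thesis
    using check_name_eqD le_in(1) by auto
qed

text \<open>Four strengthenings: to apply surjectivity, to fix a name for the preimage, to place it
  in \<open>B\<close>, and to decide which element of \<open>B\<close> it is.\<close>

lemma ex_locates:
  assumes onto: "forces P r t (fm_onto f A (check_name P B))"
    and sub: "forces P r t (fm_subset A (check_name P B))"
    and t: "t \<in> elts P" and \<delta>: "\<delta> \<in> elts B"
  obtains q \<xi> where "(q, t) \<in> r" "\<xi> \<in> elts B" "locates f A q \<xi> \<delta>"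
proof -
  let ?c = "check_name P"
  have "forces P r t (?c \<delta> \<^bold>\<in> ?c B \<^bold>\<longrightarrow> (\<^bold>\<exists>x. x \<^bold>\<in> A \<^bold>\<and> fm_related f x (?c \<delta>)))"
    by (rule onto[unfolded fm_onto_def forces.simps(5), rule_format, OF name_check_name])
  moreover have "forces P r t (?c \<delta> \<^bold>\<in> ?c B)"
    using \<delta> t by (simp add: forces_check_name_mem)
  ultimately obtain q1 where q1: "(q1, t) \<in> r" "forces P r q1 (\<^bold>\<exists>x. x \<^bold>\<in> A \<^bold>\<and> fm_related f x (?c \<delta>))"
    by (rule forces_FImpE[OF _ _ t])
  obtain q2 z where q2: "(q2, q1) \<in> r" and z: "name P z" "forces P r q2 (z \<^bold>\<in> A \<^bold>\<and> fm_related f z (?c \<delta>))"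
    by (rule forces_FExE[OF q1(2) le_in(1)[OF q1(1)]])
  have "(q2, t) \<in> r"
    using q2 q1(1) le_trans by blast
  then have "forces P r q2 (z \<^bold>\<in> A \<^bold>\<longrightarrow> z \<^bold>\<in> ?c B)"
    using forces_mono sub z(1) unfolding fm_subset_def forces.simps(5) by blast
  moreover have "forces P r q2 (z \<^bold>\<in> A)"
    using z(2) by simp
  ultimately obtain q3 where q3: "(q3, q2) \<in> r" "forces P r q3 (z \<^bold>\<in> ?c B)"
    by (rule forces_FImpE[OF _ _ le_in(1)[OF q2]])
  then obtain q4 \<xi> where q4: "(q4, q3) \<in> r" "\<xi> \<in> elts B" "forces_eq P r q4 z (?c \<xi>)"
    using forces_mem_check_nameE le_in(1) by (metis forces.simps(1))
  have "(q4, q2) \<in> r"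
    using q4(1) q3(1) le_trans by blast
  then have "forces P r q4 (z \<^bold>\<in> A \<^bold>\<and> fm_related f z (?c \<delta>))"
    using forces_mono z(2) by blast
  then have "locates f A q4 \<xi> \<delta>"
    unfolding locates_def forces.simps(4) using q4(3) z(1) forces.simps(2) by blast
  moreover have "(q4, t) \<in> r"
    using \<open>(q4, q2) \<in> r\<close> \<open>(q2, t) \<in> r\<close> le_trans by blast
  ultimately show thesis
    using that q4(2) by blast
qed

lemma adds_rainbowE:
  assumes "adds_rainbow P r c"
  obtains p A f where "p \<in> elts P" "forces P r p (fm_subset A (check_name P omega2))"
    "forces P r p (fm_onto f A (check_name P omega2))"
    "forces P r p (fm_injective f A (check_name P omega2))"
    "forces P r p (fm_rainbow (check_name P (coloring_graph c)) A)"
proof -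
  let ?W = "check_name P omega2"
  let ?\<phi> = "\<lambda>A. fm_subset A ?W \<^bold>\<and> fm_equinumerous A ?W \<^bold>\<and> fm_rainbow (check_name P (coloring_graph c)) A"
  from assms obtain p0 where p0: "p0 \<in> elts P" "forces P r p0 (FEx ?\<phi>)"
    unfolding adds_rainbow_def by blast
  obtain p1 A where p1: "(p1, p0) \<in> r" "name P A" "forces P r p1 (?\<phi> A)"
    by (rule forces_FExE[OF p0(2,1)])
  then have "forces P r p1 (fm_equinumerous A ?W)"
    unfolding forces.simps(4) by blast
  then obtain p f where p: "(p, p1) \<in> r"
    and f: "forces P r p ((\<^bold>\<forall>x. x \<^bold>\<in> A \<^bold>\<longrightarrow> (\<^bold>\<exists>y. y \<^bold>\<in> ?W \<^bold>\<and> fm_related f x y)) \<^bold>\<and>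
      fm_onto f A ?W \<^bold>\<and> fm_injective f A ?W)"
    unfolding fm_equinumerous_def fm_onto_def fm_injective_def
    by (rule forces_FExE[OF _ le_in(1)[OF p1(1)]])
  have "forces P r p (?\<phi> A)"
    by (rule forces_mono[OF p1(3) p])
  then show thesis
    using that[OF le_in(1)[OF p]] f unfolding forces.simps(4) by blast
qed

end

section \<open>Strongly proper posets add no rainbow set\<close>

locale strongly_proper_poset = forcing_poset P r
  for P :: "'v::zfc_universe" and r :: "'v rel" +
  fixes \<kappa> :: "'b rel" and S :: "'v set set"
  assumes in_hereditary: "P \<in> hereditary \<kappa>"
    and stationary: "stationary (hereditary \<kappa>) S"
    and strongly_proper: "strongly_proper P r S"
begin

text \<open>Models are subsets of H(\<kappa>), so closing them under functions on conditions
  requires the conditions to lie there.\<close>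

lemma subset_hereditary: "elts P \<subseteq> hereditary \<kappa>"
proof
  fix x assume "x \<in> elts P"
  then have "{y. (y, x) \<in> {(u, v). u \<in> elts v}\<^sup>+} \<subseteq> {y. (y, P) \<in> {(u, v). u \<in> elts v}\<^sup>+}"
    by (auto intro: trancl_into_trancl)
  then show "x \<in> hereditary \<kappa>"
    using in_hereditary ordLeq_ordLess_trans[OF card_of_mono1] by (simp add: hereditary_def)
qed

lemma ex_strongly_generic:
  assumes I: "|I| \<le>o aleph1" and p: "p \<in> elts P"
    and F: "\<And>i u. i \<in> I \<Longrightarrow> u \<in> elts P \<Longrightarrow> F i u \<in> elts P"
  obtains M q where "|M| \<le>o aleph1" "p \<in> M"
    "\<And>i u. i \<in> I \<Longrightarrow> u \<in> M \<Longrightarrow> u \<in> elts P \<Longrightarrow> F i u \<in> M"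
    "(q, p) \<in> r" "strongly_generic P r M q"
proof -
  \<comment> \<open>Extended by the identity, so that the functions act on all of
    H(\<kappa>).\<close>
  let ?F = "\<lambda>i u. if u \<in> elts P then F i u else u"
  let ?C = "{M \<in> aleph1_subsets (hereditary \<kappa>). p \<in> M \<and> (\<forall>i\<in>I. \<forall>u\<in>M. ?F i u \<in> M)}"
  have "club (hereditary \<kappa>) ?C"
    using subset_hereditary p F by (intro club_closed_under I) auto
  then have "S \<inter> ?C \<noteq> {}"
    using stationary unfolding stationary_def by simp
  then obtain M where M: "M \<in> S" "M \<in> ?C"
    by auto
  then have "p \<in> M \<inter> elts P"
    using p by simp
  then obtain q where q: "(q, p) \<in> r" "strongly_generic P r M q"
    using strongly_proper M(1) unfolding strongly_proper_def by blast
  have "F i u \<in> M" if "i \<in> I" "u \<in> M" "u \<in> elts P" for i u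
  proof -
    have "?F i u \<in> M"
      using M(2) that(1,2) by simp
    then show ?thesis
      using that(3) by simp
  qed
  moreover have "|M| \<le>o aleph1"
    using M(2) by (simp add: aleph1_subsets_def ordIso_iff_ordLeq)
  ultimately show thesis
    using that[OF _ _ _ q] M(2) by simp
qed

text \<open>A strongly generic condition confines the values of \<open>f\<close> on \<open>X\<close> to the values decided
  by conditions in \<open>M\<close>, so that \<open>f\<close> maps no set of size aleph 1 of the ground model onto \<open>B\<close>.\<close>

lemma ex_forced_outside:
  assumes p: "p \<in> elts P" and sub: "forces P r p (fm_subset A (check_name P B))"
    and onto: "forces P r p (fm_onto f A (check_name P B))"
    and inj: "forces P r p (fm_injective f A (check_name P B))"
    and B: "aleph1 <o |elts B|" and X: "|X| \<le>o aleph1"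
  obtains t \<beta> where "(t, p) \<in> r" "\<beta> \<in> elts B" "\<beta> \<notin> X" "forces_mem P r t (check_name P \<beta>) A"
proof -
  have "\<exists>t \<beta>. (t, p) \<in> r \<and> \<beta> \<in> elts B \<and> \<beta> \<notin> X \<and> forces_mem P r t (check_name P \<beta>) A"
  proof (rule ccontr)
    assume none: "\<not> ?thesis"
    \<comment> \<open>\<open>F x v\<close> will be a condition below \<open>v\<close> and
      \<open>p\<close> deciding the value of \<open>f\<close> at \<open>x\<close>, with
      \<open>v\<close> itself as default.\<close>
    let ?P = "\<lambda>x v t. (t, v) \<in> r \<and> (t, p) \<in> r \<and> (\<exists>\<delta>\<in>elts B. locates f A t x \<delta>)"
    define F where "F x v = (if \<exists>t. ?P x v t then SOME t. ?P x v t else v)" for x v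
    have F: "?P x v (F x v)" if "?P x v t" for x v t
    proof -
      have ex: "\<exists>t. ?P x v t"
        using that by (rule exI)
      then have "?P x v (SOME t. ?P x v t)"
        by (rule someI_ex)
      then show ?thesis
        using ex by (simp only: F_def if_True)
    qed
    have F_in: "F x v \<in> elts P" if "v \<in> elts P" for x v
    proof (cases "\<exists>t. ?P x v t")
      case True
      then show ?thesis
        using F le_in(1) by blast
    next
      case False
      then show ?thesis
        using that by (simp only: F_def if_False)
    qed
    obtain M q where M: "|M| \<le>o aleph1"
      and closed: "\<And>x v. x \<in> X \<Longrightarrow> v \<in> M \<Longrightarrow> v \<in> elts P \<Longrightarrow> F x v \<in> M"
      and q: "(q, p) \<in> r" "strongly_generic P r M q"
      using ex_strongly_generic[OF X p, of F] F_in by metis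
    \<comment> \<open>All values decided by conditions in \<open>M\<close> at points of
      \<open>X\<close>. Each condition decides at most one value per point, so there are at most
      aleph 1.\<close>
    define \<Delta> where "\<Delta> = (\<Union>x\<in>X. \<Union>t\<in>M. {\<delta> \<in> elts B. (t, p) \<in> r \<and> locates f A t x \<delta>})"
    have "|{\<delta> \<in> elts B. (t, p) \<in> r \<and> locates f A t x \<delta>}| \<le>o aleph1" (is "|?L| \<le>o _") for t x
    proof -
      have "\<delta> = \<delta>'" if "\<delta> \<in> ?L" "\<delta>' \<in> ?L" for \<delta> \<delta>'
        using that locates_unique[OF forces_mono[OF inj]] le_in(1) by blast
      then have "?L = {} \<or> (\<exists>\<delta>. ?L = {\<delta>})"
        by blast
      then have "countable ?L"
        by (elim disjE exE) (simp_all only: countable_empty countable_insert)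
      then show ?thesis
        by (rule countable_imp_ordLeq_aleph1)
    qed
    then have "|\<Delta>| \<le>o aleph1"
      unfolding \<Delta>_def by (intro UN_aleph1_bound X M)
    then have "\<not> elts B \<subseteq> \<Delta>"
      using B card_of_mono1 not_ordLess_ordLeq ordLeq_transitive by metis
    then obtain \<delta> where \<delta>: "\<delta> \<in> elts B" "\<delta> \<notin> \<Delta>"
      by blast
    obtain q' \<xi> where q': "(q', q) \<in> r" "\<xi> \<in> elts B" "locates f A q' \<xi> \<delta>"
      by (rule ex_locates[OF forces_mono[OF onto q(1)] forces_mono[OF sub q(1)] le_in(1)[OF q(1)] \<delta>(1)])
    have q'p: "(q', p) \<in> r"
      using q'(1) q(1) by (rule le_trans)
    have \<xi>: "\<xi> \<in> X"
      using none q'p q'(2) locates_mem[OF q'(3)] by blast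
    obtain v where v: "v \<in> M" "v \<in> elts P" "\<And>t. t \<in> M \<Longrightarrow> (t, v) \<in> r \<Longrightarrow> compatible r t q'"
      using q(2) q'(1) unfolding strongly_generic_def by blast
    obtain s where s: "(s, v) \<in> r" "(s, q') \<in> r"
      using v(3)[OF v(1) le_refl[OF v(2)]] unfolding compatible_def by blast
    \<comment> \<open>The common extension \<open>s\<close> shows that \<xi> can be decided below
      \<open>v\<close>, so \<open>F \<xi> v\<close> decides it inside \<open>M\<close>. Being
      compatible with \<open>q'\<close>, it must give the value \<delta>, which was chosen outside
      \<open>\<Delta>\<close>.\<close>
    have "?P \<xi> v s"
      using s \<delta>(1) locates_mono[OF q'(3) s(2)] le_trans[OF s(2) q'p] by blast
    then have "?P \<xi> v (F \<xi> v)"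
      by (rule F)
    then obtain \<delta>' where \<delta>': "\<delta>' \<in> elts B" "locates f A (F \<xi> v) \<xi> \<delta>'"
      and Fv: "(F \<xi> v, v) \<in> r" "(F \<xi> v, p) \<in> r"
      by blast
    have FM: "F \<xi> v \<in> M"
      by (rule closed[OF \<xi> v(1,2)])
    then have "\<delta>' \<in> \<Delta>"
      unfolding \<Delta>_def using \<xi> \<delta>' Fv(2) by blast
    obtain s' where s': "(s', F \<xi> v) \<in> r" "(s', q') \<in> r"
      using v(3)[OF FM Fv(1)] unfolding compatible_def by blast
    have "\<delta> = \<delta>'"
      using locates_unique[OF forces_mono[OF inj le_trans[OF s'(2) q'p]] le_in(1)[OF s'(1)]
        locates_mono[OF q'(3) s'(2)] locates_mono[OF \<delta>'(2) s'(1)] \<delta>(1) \<delta>'(1)] .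
    then show False
      using \<open>\<delta>' \<in> \<Delta>\<close> \<delta>(2) by simp
  qed
  then show thesis
    using that by blast
qed

lemma not_adds_rainbow:
  fixes I :: "'i set"
  assumes I: "|I| \<le>o aleph1" and W: "aleph1 <o |elts (omega2 :: 'v)|"
    and c: "\<And>g. g \<in> Func I (elts omega2 \<times> elts omega2) \<Longrightarrow> disjoint_pairs I g \<Longrightarrow>
      \<exists>X. |X| \<le>o aleph1 \<and> (\<forall>\<beta>\<in>elts omega2 - X. \<exists>i\<in>I. fst (g i) \<noteq> \<beta> \<and> snd (g i) \<noteq> \<beta> \<and>
         c {fst (g i), \<beta>} = c {snd (g i), \<beta>})"
  shows "\<not> adds_rainbow P r c"
proof
  assume "adds_rainbow P r c"
  then obtain p A f where p: "p \<in> elts P" and sub: "forces P r p (fm_subset A (check_name P omega2))"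
    and onto: "forces P r p (fm_onto f A (check_name P omega2))"
    and inj: "forces P r p (fm_injective f A (check_name P omega2))"
    and rainbow: "forces P r p (fm_rainbow (check_name P (coloring_graph c)) A)"
    by (rule adds_rainbowE)
  let ?W = "elts (omega2 :: 'v)"
  let ?in = "\<lambda>t a. forces_mem P r t (check_name P a) A"
  have outside: "\<exists>t \<beta>. (t, u) \<in> r \<and> \<beta> \<in> ?W \<and> \<beta> \<notin> X \<and> ?in t \<beta>" if "(u, p) \<in> r" "|X| \<le>o aleph1" for u X
    by (rule ex_forced_outside[OF le_in(1)[OF that(1)] forces_mono[OF sub that(1)]
          forces_mono[OF onto that(1)] forces_mono[OF inj that(1)] W that(2)]) blast
  let ?Q = "\<lambda>u g t. g \<in> Func I (?W \<times> ?W) \<and> disjoint_pairs I g \<and>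
    (\<forall>i\<in>I. (t i, u) \<in> r \<and> ?in (t i) (fst (g i)) \<and> ?in (t i) (snd (g i)))"
  \<comment> \<open>The restriction of \<open>q'\<close> to \<open>M\<close> will only be known to
    be compatible with \<open>p\<close>, not to lie below it, so families are chosen for all such
    \<open>u\<close>.\<close>
  have "\<exists>g t. ?Q u g t" if compat: "compatible r u p" for u
  proof -
    obtain v where v: "(v, u) \<in> r" "(v, p) \<in> r"
      using compat unfolding compatible_def by blast
    \<comment> \<open>Pairs that one condition below \<open>v\<close> forces into \<open>A\<close>.
      Applying \<open>outside\<close> below \<open>v\<close> and again below the condition just
      found gives such a pair off any countable set.\<close>
    define G where "G = {(a, b). a \<in> ?W \<and> b \<in> ?W \<and> (\<exists>t. (t, v) \<in> r \<and> ?in t a \<and> ?in t b)}"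
    have "\<exists>D. (\<forall>i\<in>I. D i \<in> G) \<and> disjoint_pairs I D"
    proof (rule ex_disjoint_pairs[OF I])
      fix X :: "'v set" assume X: "countable X"
      obtain t1 a where t1: "(t1, v) \<in> r" "a \<in> ?W" "a \<notin> X" "?in t1 a"
        using outside[OF v(2) countable_imp_ordLeq_aleph1[OF X]] by blast
      have "countable (insert a X)"
        using X by simp
      then obtain t2 b where t2: "(t2, t1) \<in> r" "b \<in> ?W" "b \<notin> insert a X" "?in t2 b"
        using outside[OF le_trans[OF t1(1) v(2)] countable_imp_ordLeq_aleph1] by blast
      have "(a, b) \<in> G"
        unfolding G_def using t1 t2 le_trans[OF t2(1) t1(1)] forces_mem_mono[OF t1(4) t2(1)] by blast
      then show "\<exists>(a, b)\<in>G. a \<noteq> b \<and> a \<notin> X \<and> b \<notin> X"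
        using t1(3) t2(3) by (intro bexI[of _ "(a, b)"]) auto
    qed
    then obtain D where D: "\<And>i. i \<in> I \<Longrightarrow> D i \<in> G" "disjoint_pairs I D"
      by blast
    \<comment> \<open>Membership in \<open>Func\<close> requires the value \<open>undefined\<close>
      outside \<open>I\<close>.\<close>
    define g where "g i = (if i \<in> I then D i else undefined)" for i
    have "\<exists>t. (t, u) \<in> r \<and> ?in t (fst (g i)) \<and> ?in t (snd (g i))" if i: "i \<in> I" for i
    proof -
      obtain t where "(t, v) \<in> r" "?in t (fst (D i))" "?in t (snd (D i))"
        using D(1)[OF i] by (auto simp: G_def)
      then show ?thesis
        using le_trans[OF _ v(1)] i by (auto simp: g_def)
    qed
    then obtain t where "\<forall>i\<in>I. (t i, u) \<in> r \<and> ?in (t i) (fst (g i)) \<and> ?in (t i) (snd (g i))"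
      by metis
    moreover have "g \<in> Func I (?W \<times> ?W)"
      using D(1) by (auto simp: g_def G_def Func_def mem_Times_iff split_beta)
    moreover have "disjoint_pairs I g"
      using D(2) by (simp add: g_def disjoint_pairs_def)
    ultimately show ?thesis
      by blast
  qed
  then obtain G T where GT: "\<And>u. compatible r u p \<Longrightarrow> ?Q u (G u) (T u)"
    by metis
  define F where "F i u = (if compatible r u p then T u i else u)" for i u
  have F_in: "F i u \<in> elts P" if "i \<in> I" "u \<in> elts P" for i u
    using that GT[of u] le_in(1) by (auto simp: F_def)
  obtain M q where M: "|M| \<le>o aleph1"
    and closed: "\<And>i u. i \<in> I \<Longrightarrow> u \<in> M \<Longrightarrow> u \<in> elts P \<Longrightarrow> F i u \<in> M"
    and q: "(q, p) \<in> r" "strongly_generic P r M q"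
    using ex_strongly_generic[OF I p, of F] F_in by metis
  have "\<exists>X. compatible r u p \<longrightarrow> |X| \<le>o aleph1 \<and> (\<forall>\<beta>\<in>?W - X. \<exists>i\<in>I. fst (G u i) \<noteq> \<beta> \<and> snd (G u i) \<noteq> \<beta> \<and>
         c {fst (G u i), \<beta>} = c {snd (G u i), \<beta>})" for u
    using c[of "G u"] GT[of u] by blast
  then obtain X where X: "\<And>u. compatible r u p \<Longrightarrow> |X u| \<le>o aleph1"
    and X_same: "\<And>u \<beta>. compatible r u p \<Longrightarrow> \<beta> \<in> ?W - X u \<Longrightarrow>
      \<exists>i\<in>I. fst (G u i) \<noteq> \<beta> \<and> snd (G u i) \<noteq> \<beta> \<and> c {fst (G u i), \<beta>} = c {snd (G u i), \<beta>}"
    by metis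
  \<comment> \<open>Together the exceptional sets of all families from \<open>M\<close> have size at
    most aleph 1, so a condition below \<open>q\<close> forces into \<open>A\<close> some \<beta>
    outside all of them.\<close>
  have "|{u \<in> M. compatible r u p}| \<le>o aleph1"
    by (rule ordLeq_transitive[OF card_of_mono1 M]) blast
  then have "|\<Union>u\<in>{u \<in> M. compatible r u p}. X u| \<le>o aleph1"
    using X by (intro UN_aleph1_bound) auto
  then obtain q' \<beta> where q': "(q', q) \<in> r" and \<beta>: "\<beta> \<in> ?W" "?in q' \<beta>"
    "\<beta> \<notin> (\<Union>u\<in>{u \<in> M. compatible r u p}. X u)"
    using outside[OF q(1)] by blast
  obtain v where v: "v \<in> M" "v \<in> elts P" "\<And>t. t \<in> M \<Longrightarrow> (t, v) \<in> r \<Longrightarrow> compatible r t q'"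
    using q(2) q' unfolding strongly_generic_def by blast
  have q'p: "(q', p) \<in> r"
    using q' q(1) by (rule le_trans)
  have vp: "compatible r v p"
    using v(3)[OF v(1) le_refl[OF v(2)]] le_trans[OF _ q'p] unfolding compatible_def by blast
  then obtain i where i: "i \<in> I" "fst (G v i) \<noteq> \<beta>" "snd (G v i) \<noteq> \<beta>"
    "c {fst (G v i), \<beta>} = c {snd (G v i), \<beta>}"
    using X_same[OF vp, of \<beta>] \<beta> v(1) by blast
  \<comment> \<open>\<open>T v i\<close> lies in \<open>M\<close> and below \<open>v\<close>, so it
    is compatible with \<open>q'\<close>. A common extension forces \<beta> and both ends of the
    edge into \<open>A\<close>.\<close>
  have Tv: "T v i \<in> M" "(T v i, v) \<in> r"
    using closed[OF i(1) v(1,2)] vp GT[OF vp] i(1) by (auto simp: F_def)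
  then obtain s where s: "(s, T v i) \<in> r" "(s, q') \<in> r"
    using v(3) unfolding compatible_def by blast
  have "?in s (fst (G v i))" "?in s (snd (G v i))" "?in s \<beta>"
    using GT[OF vp] i(1) forces_mem_mono[OF _ s(1)] forces_mem_mono[OF \<beta>(2) s(2)] by blast+
  moreover have "fst (G v i) \<in> ?W" "snd (G v i) \<in> ?W" "fst (G v i) \<noteq> snd (G v i)"
    using GT[OF vp] i(1) by (auto simp: Func_def disjoint_pairs_def mem_Times_iff)
  ultimately show False
    using fm_rainbow_contradiction[OF forces_mono[OF rainbow le_trans[OF s(2) q'p]], of "fst (G v i)" "snd (G v i)" \<beta>]
      \<beta>(1) i le_in(1)[OF s(1)] by blast
qed

end

theorem theorem2p3:
  assumes "|Pow (elts (omega1 :: 'v::zfc_universe))| =o |elts (omega2 :: 'v)|"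
  shows "\<exists>c. c \<in> [elts (omega2 :: 'v)]\<^bsup>2\<^esup> \<rightarrow> elts omega2 \<and> two_bounded c \<and>
    (\<forall>P r. partial_order_on (elts P) r \<and> P \<in> hereditary (cardSuc |Pow (elts P)| ) \<and>
       (\<exists>S. stationary (hereditary (cardSuc |Pow (elts P)| )) S \<and> strongly_proper P r S)
       \<longrightarrow> \<not> adds_rainbow P r c)"
proof -
  let ?W = "elts (omega2 :: 'v)"
  \<comment> \<open>The field of \<open>aleph1\<close> serves as the index set of the
    sequences.\<close>
  have card_Field: "|Field aleph1| =o aleph1"
    using card_of_Field_ordIso Cinfinite_aleph1 by blast
  obtain c where c: "c \<in> [?W]\<^bsup>2\<^esup> \<rightarrow> ?W"
    and bounded: "\<forall>v\<in>?W. finite {e \<in> [?W]\<^bsup>2\<^esup>. c e = v} \<and> card {e \<in> [?W]\<^bsup>2\<^esup>. c e = v} \<le> 2"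
    and same: "\<And>g. g \<in> Func (Field aleph1) (?W \<times> ?W) \<Longrightarrow> disjoint_pairs (Field aleph1) g \<Longrightarrow>
      \<exists>X. |X| \<le>o aleph1 \<and> (\<forall>\<beta>\<in>?W - X. \<exists>i\<in>Field aleph1. fst (g i) \<noteq> \<beta> \<and> snd (g i) \<noteq> \<beta> \<and>
         c {fst (g i), \<beta>} = c {snd (g i), \<beta>})"
    using ex_two_bounded_coloring[OF card_omega2[OF assms] card_Field card_omega2_sequences[OF assms]] by blast
  have W: "aleph1 <o |?W|"
    by (rule ordLess_ordIso_trans[OF cardSuc_greater ordIso_symmetric[OF card_omega2[OF assms]]])
      (use Cinfinite_aleph1 in blast)
  have "\<not> adds_rainbow P r c"
    if "partial_order_on (elts P) r" "P \<in> hereditary (cardSuc |Pow (elts P)| )"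
      "stationary (hereditary (cardSuc |Pow (elts P)| )) S" "strongly_proper P r S"
    for P r and S :: "'v set set"
  proof -
    interpret strongly_proper_poset P r "cardSuc |Pow (elts P)|" S
      using that by unfold_locales
    show ?thesis
      using card_Field by (intro not_adds_rainbow[OF _ W same]) (auto simp: ordIso_iff_ordLeq)
  qed
  then show ?thesis
    using c bounded unfolding two_bounded_def by (intro exI[of _ c]) blast
qed

end
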